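(* For every prime $p\neq 5$ and every integer $a\geq 1$, the group $\mathrm{SL}_{12}(p^a)$ is $(2,3)$-generated.
   Context: A group $G$ is called $(2,3)$-generated if there exist an element $x\in G$ of order exactly $2$ and an element $y\in G$ of order exactly $3$ such that $G=\langle x,y\rangle$. $\mathrm{SL}_{12}(q)$ denotes the group of $12\times 12$ matrices of determinant $1$ over the field $\mathbb{F}_q$ with $q$ elements. *)

theory Defs
  imports
    "HOL-Computational_Algebra.Primes"
    "HOL-Library.Cardinality"
    "HOL-Algebra.Multiplicative_Group"
    "HOL-Algebra.Generated_Groups"
    "Jordan_Normal_Form.Determinant"
begin

definition two_three_generated :: "('a, 'b) monoid_scheme \<Rightarrow> bool" where
  "two_three_generated G \<longleftrightarrow>
     group G \<and>
     (\<exists>x \<in> carrier G. \<exists>y \<in> carrier G.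
        group.ord G x = 2 \<and> group.ord G y = 3 \<and> generate G {x, y} = carrier G)"

(* The base ring is the type 'a, passed as an itself-argument as in ring_mat. *)
definition SL :: "nat \<Rightarrow> 'a::comm_ring_1 itself \<Rightarrow> 'a mat monoid" where
  "SL n ty = \<lparr>carrier = {A \<in> carrier_mat n n. det A = 1}, monoid.mult = (*), one = 1\<^sub>m n\<rparr>"

lemma group_SL: "group (SL n TYPE('a::comm_ring_1))"
proof (rule groupI)
  fix A :: "'a mat" assume "A \<in> carrier (SL n TYPE('a))"
  then have A: "A \<in> carrier_mat n n" "det A = 1" by (auto simp: SL_def)
  have adj: "adj_mat A \<in> carrier_mat n n" "adj_mat A * A = 1\<^sub>m n"
    using adj_mat[OF A(1)] A(2) by auto
  have "det (adj_mat A) = 1"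
    using det_mult[OF adj(1) A(1)] adj(2) A(2) by simp
  then show "\<exists>B \<in> carrier (SL n TYPE('a)). B \<otimes>\<^bsub>SL n TYPE('a)\<^esub> A = \<one>\<^bsub>SL n TYPE('a)\<^esub>"
    using adj by (auto simp: SL_def)
qed (auto simp: SL_def det_mult)

end

(*
  Let t generate the multiplicative group of the field. The matrices X (of order 2, depending on t)
  and Y (of order 3) are monomial up to a single entry t of X, and XY is a 5-cycle coupled to a
  7-cycle by that entry, so (XY)^35 is a transvection I + t s sigma^T fixed by conjugation with XY.

  Write T(u, phi) = I + u phi^T. If T(u, phi) and T(v, psi) lie in the generated group H and
  phi(v) = 0, then so does T(psi(u) v, phi). Applied to conjugates of the transvection above, this
  yields an additive set of vectors u with T(u, sigma) in H which is stable under XY, closed under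
  multiplication by t along a loop, and finally equal to the kernel of sigma. All pivots are units
  of Z[t, 1/t], so the argument is uniform in the characteristic. The functionals phi for which
  all T(u, phi) with phi(u) = 0 lie in H form, together with 0, an H-invariant subspace; it contains
  sigma and turns out to be the whole dual space, so H contains every elementary matrix.
*)

theory Submission
  imports
    Defs
    "Jordan_Normal_Form.Gauss_Jordan_Elimination"
    "Jordan_Normal_Form.VS_Connect"
begin

subsection \<open>Transvections\<close>

lemma zero_column_det:
  fixes A :: "'a::field mat"
  assumes A: "A \<in> carrier_mat n n" and k: "k < n"
    and unit: "\<And>i j. i < n \<Longrightarrow> j < k \<Longrightarrow> A $$ (i, j) = (if i = j then 1 else 0)"
    and zero: "\<And>i. k \<le> i \<Longrightarrow> i < n \<Longrightarrow> A $$ (i, k) = 0"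
  shows "det A = 0"
proof -
  \<comment> \<open>Column \<open>k\<close> is a combination of the earlier unit columns;
    \<open>v\<close> records this dependence and so is a nonzero kernel vector.\<close>
  define v where "v = vec n (\<lambda>j. if j = k then 1 else if j < k then - A $$ (j, k) else 0)"
  have "(A *\<^sub>v v) $ i = 0" if i: "i < n" for i
  proof -
    have "(A *\<^sub>v v) $ i = (\<Sum>j\<in>{0..<n}. A $$ (i, j) * v $ j)"
      using A i by (simp add: scalar_prod_def v_def)
    also have "\<dots> = (\<Sum>j\<in>{0..<n}. (if j = k then A $$ (i, k) else 0)
                               + (if j = i then (if i < k then - A $$ (i, k) else 0) else 0))"
      by (rule sum.cong) (use k i unit in \<open>auto simp: v_def\<close>)
    also have "\<dots> = A $$ (i, k) + (if i < k then - A $$ (i, k) else 0)"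
      using i k by (simp add: sum.distrib)
    finally show ?thesis using zero[of i] i by (cases "i < k") auto
  qed
  then have "A *\<^sub>v v = 0\<^sub>v n" using A by (intro eq_vecI) auto
  moreover have "v \<noteq> 0\<^sub>v n"
  proof
    assume "v = 0\<^sub>v n"
    then have "v $ k = 0" using k by simp
    then show False using k by (simp add: v_def)
  qed
  moreover have "v \<in> carrier_vec n" by (simp add: v_def)
  ultimately show ?thesis using det_0_iff_vec_prod_zero_field[OF A] by blast
qed

text \<open>Elementary matrices generate SL_n over a field. The step runs backwards, from the
  reduced matrix to \<open>B\<close>, so that reducing \<open>A\<close> to the identity proves
  \<open>P A\<close>. Rows may be neither scaled nor swapped, which dictates how pivots are
  made.\<close>

lemma SL_row_induct [consumes 2, case_names one addrow]:
  fixes A :: "'a::field mat"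
  assumes "A \<in> carrier_mat n n" and "det A = 1"
    and one: "P (1\<^sub>m n)"
    and step: "\<And>B a k l. B \<in> carrier_mat n n \<Longrightarrow> k < n \<Longrightarrow> l < n \<Longrightarrow> k \<noteq> l \<Longrightarrow>
                 P (addrow a k l B) \<Longrightarrow> P B"
  shows "P A"
proof -
  define U where "U m B \<longleftrightarrow> (\<forall>i<n. \<forall>j<m. B $$ (i, j) = (if i = j then 1 else (0::'a)))" for m B
  \<comment> \<open>Induction on the number \<open>m\<close> of columns still to be reduced;
    \<open>U\<close> says that the columns before them are already unit columns.\<close>
  have main: "P B" if "m \<le> n" "B \<in> carrier_mat n n" "det B = 1" "U (n - m) B" for m B
    using that
  proof (induction m arbitrary: B)
    case 0
    then have "B = 1\<^sub>m n" by (intro eq_matI) (auto simp: U_def)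
    then show ?case using one by simp
  next
    case (Suc m)
    define k where "k = n - Suc m"
    have k: "k < n" "n - m = Suc k" "n - Suc m = k" using Suc.prems(1) by (auto simp: k_def)
    have det': "det (addrow a i j C) = 1" and carr': "addrow a i j C \<in> carrier_mat n n"
      and U': "(j = k \<or> k < j) \<Longrightarrow> U k C \<Longrightarrow> U k (addrow a i j C)"
      if "C \<in> carrier_mat n n" "det C = 1" "i < n" "j < n" "i \<noteq> j" for C a i j
      using that k det_addrow[of j n i C a] by (auto simp: U_def)
    \<comment> \<open>Once the pivot is 1, the other nonzero entries of column \<open>k\<close> are
      removed one at a time, by induction on their number.\<close>
    have clear: "P C" if "C \<in> carrier_mat n n" "det C = 1" "U k C" "C $$ (k, k) = 1" for C
      using that
    proof (induction "card {i. i < n \<and> i \<noteq> k \<and> C $$ (i, k) \<noteq> 0}" arbitrary: C)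
      case 0
      then have "{i. i < n \<and> i \<noteq> k \<and> C $$ (i, k) \<noteq> 0} = {}" by simp
      then have "U (Suc k) C" using 0 by (auto simp: U_def less_Suc_eq)
      then show ?case using Suc.IH[of C] Suc.prems 0 k by simp
    next
      case (Suc c)
      then have "{i. i < n \<and> i \<noteq> k \<and> C $$ (i, k) \<noteq> 0} \<noteq> {}" by (metis card.empty nat.simps(3))
      then obtain i where i: "i < n" "i \<noteq> k" "C $$ (i, k) \<noteq> 0" by blast
      let ?D = "addrow (- C $$ (i, k)) i k C"
      have "{r. r < n \<and> r \<noteq> k \<and> ?D $$ (r, k) \<noteq> 0} = {r. r < n \<and> r \<noteq> k \<and> C $$ (r, k) \<noteq> 0} - {i}"
        using i k Suc.prems by (auto split: if_splits)
      moreover have "i \<in> {r. r < n \<and> r \<noteq> k \<and> C $$ (r, k) \<noteq> 0}" using i by simp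
      ultimately have "card {r. r < n \<and> r \<noteq> k \<and> ?D $$ (r, k) \<noteq> 0} = c"
        using Suc.hyps(2) by (metis card_Diff_singleton diff_Suc_1)
      moreover have "?D $$ (k, k) = 1" using i k Suc.prems by auto
      ultimately have "P ?D"
        using Suc.hyps(1)[of ?D] det'[of C i k] carr'[of C i k] U'[of C i k] Suc.prems i k by auto
      then show ?case using step[of C i k] Suc.prems i k by auto
    qed
    \<comment> \<open>A nonzero entry below the pivot position allows a single row addition to turn
      the pivot into 1.\<close>
    have below: "P C" if C: "C \<in> carrier_mat n n" "det C = 1" "U k C"
      and i: "k < i" "i < n" "C $$ (i, k) \<noteq> 0" for C i
    proof -
      let ?D = "addrow ((1 - C $$ (k, k)) / C $$ (i, k)) k i C"
      have "P ?D"
        by (rule clear) (use det'[of C k i] carr'[of C k i] U'[of C k i] C i k in auto)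
      then show ?thesis using step[of C k i] C i k by auto
    qed
    show ?case
    proof (cases "\<exists>i. k < i \<and> i < n \<and> B $$ (i, k) \<noteq> 0")
      case True
      then show ?thesis using below Suc.prems k by auto
    next
      case False
      have UB: "U k B" using Suc.prems k by simp
      have "B $$ (k, k) \<noteq> 0"
      proof
        assume "B $$ (k, k) = 0"
        then have "det B = 0"
          by (intro zero_column_det[of B n k]) (use False UB Suc.prems k in \<open>auto simp: U_def le_less\<close>)
        then show False using Suc.prems by simp
      qed
      show ?thesis
      proof (cases "Suc k < n")
        case True
        \<comment> \<open>Adding the pivot row to the next row creates the nonzero entry that
          \<open>below\<close> asks for.\<close>
        have "P (addrow 1 (Suc k) k B)"
          by (rule below[of _ "Suc k"])
            (use det'[of B "Suc k" k] carr'[of B "Suc k" k] U'[of B "Suc k" k] Suc.prems UB k True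
                \<open>B $$ (k, k) \<noteq> 0\<close> False in auto)
        then show ?thesis using step[of B "Suc k" k] Suc.prems True k by auto
      next
        case last: False
        \<comment> \<open>In the last column no row is left below, but there the pivot equals the
          determinant, hence 1.\<close>
        then have n: "n = Suc k" using k by simp
        have "upper_triangular B" using UB Suc.prems n by (auto simp: U_def)
        then have "det B = prod_list (diag_mat B)" using det_upper_triangular Suc.prems by blast
        also have "\<dots> = (\<Prod>i = 0..<n. B $$ (i, i))" using Suc.prems by (simp add: prod_list_diag_prod)
        also have "\<dots> = (\<Prod>i = 0..<n. if i = k then B $$ (k, k) else 1)"
          by (rule prod.cong) (use UB n in \<open>auto simp: U_def\<close>)
        also have "\<dots> = B $$ (k, k)" using k by simp
        finally have "B $$ (k, k) = 1" using Suc.prems by simp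
        then show ?thesis using clear Suc.prems UB by simp
      qed
    qed
  qed
  show ?thesis using main[of n A] assms by (simp add: U_def)
qed

section \<open>Algebra of the matrices I + u phi^T\<close>

definition transv :: "'a::comm_ring_1 vec \<Rightarrow> 'a vec \<Rightarrow> 'a mat" where
  "transv u \<phi> = mat (dim_vec u) (dim_vec u) (\<lambda>(i, j). (if i = j then 1 else 0) + u $ i * \<phi> $ j)"

lemma transv_carrier [simp]: "u \<in> carrier_vec n \<Longrightarrow> transv u \<phi> \<in> carrier_mat n n"
  by (auto simp: transv_def)

text \<open>Unit vectors pick out the columns. Matrix identities thereby become computations with
  one symbolic vector.\<close>

lemma mat_eq_if_mult_vec_eq:
  fixes A B :: "'a::comm_ring_1 mat"
  assumes A: "A \<in> carrier_mat n n" and B: "B \<in> carrier_mat n n"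
    and eq: "\<And>v. v \<in> carrier_vec n \<Longrightarrow> A *\<^sub>v v = B *\<^sub>v v"
  shows "A = B"
proof (rule eq_matI)
  fix i j assume "i < dim_row B" "j < dim_col B"
  then have ij: "i < n" "j < n" using B by auto
  have "(A *\<^sub>v unit_vec n j) $ i = (B *\<^sub>v unit_vec n j) $ i" using eq by simp
  then show "A $$ (i, j) = B $$ (i, j)" using ij A B by simp
qed (use A B in auto)

lemma transv_mult_vec:
  assumes u: "u \<in> carrier_vec n" and p: "\<phi> \<in> carrier_vec n" and v: "v \<in> carrier_vec n"
  shows "transv u \<phi> *\<^sub>v v = v + (\<phi> \<bullet> v) \<cdot>\<^sub>v u"
proof (rule eq_vecI)
  fix i assume "i < dim_vec (v + (\<phi> \<bullet> v) \<cdot>\<^sub>v u)"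
  then have i: "i < n" using u by simp
  have "(transv u \<phi> *\<^sub>v v) $ i = (\<Sum>j = 0..<n. ((if i = j then 1 else 0) + u $ i * \<phi> $ j) * v $ j)"
    using i u p v by (simp add: transv_def scalar_prod_def)
  also have "\<dots> = (\<Sum>j = 0..<n. (if i = j then v $ j else 0) + u $ i * (\<phi> $ j * v $ j))"
    by (rule sum.cong) (auto simp: algebra_simps)
  also have "\<dots> = v $ i + u $ i * (\<phi> \<bullet> v)"
    using i v by (simp add: sum.distrib scalar_prod_def sum_distrib_left)
  finally show "(transv u \<phi> *\<^sub>v v) $ i = (v + (\<phi> \<bullet> v) \<cdot>\<^sub>v u) $ i"
    using i u v by (simp add: mult.commute)
qed (use u v in \<open>auto simp: transv_def\<close>)

text \<open>The cross term of the product carries the factor phi(v) = 0, so for a fixed functional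
  the vectors add.\<close>

lemma transv_mult_transv:
  assumes u: "u \<in> carrier_vec n" and v: "v \<in> carrier_vec n" and p: "\<phi> \<in> carrier_vec n"
    and "\<phi> \<bullet> v = 0"
  shows "transv u \<phi> * transv v \<phi> = transv (u + v) \<phi>"
proof (rule mat_eq_if_mult_vec_eq[of _ n])
  fix w :: "'a vec" assume w: "w \<in> carrier_vec n"
  have "transv u \<phi> * transv v \<phi> *\<^sub>v w = transv u \<phi> *\<^sub>v (w + (\<phi> \<bullet> w) \<cdot>\<^sub>v v)"
    using u v p w by (subst assoc_mult_mat_vec[of _ n n _ n]) (auto simp: transv_mult_vec)
  also have "\<dots> = (w + (\<phi> \<bullet> w) \<cdot>\<^sub>v v) + (\<phi> \<bullet> w) \<cdot>\<^sub>v u"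
    using u v p w assms(4) by (simp add: transv_mult_vec scalar_prod_add_distrib[of _ n])
  also have "\<dots> = transv (u + v) \<phi> *\<^sub>v w"
    using u v p w by (subst transv_mult_vec[of _ n]) (auto simp: algebra_simps intro!: eq_vecI)
  finally show "transv u \<phi> * transv v \<phi> *\<^sub>v w = transv (u + v) \<phi> *\<^sub>v w" .
qed (use u v p in \<open>auto intro!: mult_carrier_mat[of _ n n] transv_carrier\<close>)

lemma transpose_transv:
  "u \<in> carrier_vec n \<Longrightarrow> \<phi> \<in> carrier_vec n \<Longrightarrow> (transv u \<phi>)\<^sup>T = transv \<phi> u"
  by (intro eq_matI) (auto simp: transv_def mult.commute)

lemma transv_zero [simp]: "transv (0\<^sub>v n) \<phi> = 1\<^sub>m n"
  by (intro eq_matI) (auto simp: transv_def)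

lemma transv_smult_functional:
  "u \<in> carrier_vec n \<Longrightarrow> \<phi> \<in> carrier_vec n \<Longrightarrow> transv u (c \<cdot>\<^sub>v \<phi>) = transv (c \<cdot>\<^sub>v u) \<phi>"
  by (intro eq_matI) (auto simp: transv_def)

text \<open>Here \<open>B\<close> is the inverse of \<open>A\<close>: vectors move by
  \<open>A\<close>, functionals by precomposition with \<open>B\<close>, whence the
  transpose.\<close>

lemma conjugate_transv:
  fixes A B :: "'a::field mat"
  assumes A: "A \<in> carrier_mat n n" and B: "B \<in> carrier_mat n n" and AB: "A * B = 1\<^sub>m n"
    and u: "u \<in> carrier_vec n" and p: "\<phi> \<in> carrier_vec n"
  shows "A * transv u \<phi> * B = transv (A *\<^sub>v u) (B\<^sup>T *\<^sub>v \<phi>)"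
proof (rule mat_eq_if_mult_vec_eq[of _ n])
  fix w :: "'a vec" assume w: "w \<in> carrier_vec n"
  have Bw: "B *\<^sub>v w \<in> carrier_vec n" using B w by auto
  have "A * transv u \<phi> * B *\<^sub>v w = A *\<^sub>v (transv u \<phi> *\<^sub>v (B *\<^sub>v w))"
    using A B u w by (simp add: assoc_mult_mat_vec[of _ n n _ n] mult_carrier_mat[of _ n n])
  also have "\<dots> = A *\<^sub>v (B *\<^sub>v w) + (\<phi> \<bullet> (B *\<^sub>v w)) \<cdot>\<^sub>v (A *\<^sub>v u)"
    using A Bw u p by (simp add: transv_mult_vec mult_add_distrib_mat_vec[of _ n n] mult_mat_vec[OF A u])
  also have "A *\<^sub>v (B *\<^sub>v w) = w"
    using A B AB w by (simp flip: assoc_mult_mat_vec)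
  also have "\<phi> \<bullet> (B *\<^sub>v w) = (B\<^sup>T *\<^sub>v \<phi>) \<bullet> w"
    using transpose_vec_mult_scalar[OF B w p] by simp
  also have "w + ((B\<^sup>T *\<^sub>v \<phi>) \<bullet> w) \<cdot>\<^sub>v (A *\<^sub>v u) = transv (A *\<^sub>v u) (B\<^sup>T *\<^sub>v \<phi>) *\<^sub>v w"
    using A B u p w by (subst transv_mult_vec[of _ n]) auto
  finally show "A * transv u \<phi> * B *\<^sub>v w = transv (A *\<^sub>v u) (B\<^sup>T *\<^sub>v \<phi>) *\<^sub>v w" .
qed (use A B u p in \<open>auto intro!: mult_carrier_mat transv_carrier\<close>)

lemma independent_functionals:
  fixes \<phi> \<psi> :: "'a::field vec"
  assumes p: "\<phi> \<in> carrier_vec n" and q: "\<psi> \<in> carrier_vec n" and "\<psi> \<noteq> 0\<^sub>v n"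
    and indep: "\<And>c. \<phi> \<noteq> c \<cdot>\<^sub>v \<psi>"
  obtains u where "u \<in> carrier_vec n" "\<psi> \<bullet> u = 0" "\<phi> \<bullet> u = 1"
proof -
  have "\<exists>j<n. \<psi> $ j \<noteq> 0"
  proof (rule ccontr)
    assume "\<not> ?thesis"
    then have "\<psi> = 0\<^sub>v n" using q by (intro eq_vecI) auto
    then show False using assms(3) by simp
  qed
  then obtain j where j: "j < n" "\<psi> $ j \<noteq> 0" by blast
  have "\<exists>i<n. \<phi> $ i * \<psi> $ j \<noteq> \<phi> $ j * \<psi> $ i"
  proof (rule ccontr)
    assume "\<not> ?thesis"
    then have "\<phi> = (\<phi> $ j / \<psi> $ j) \<cdot>\<^sub>v \<psi>" using p q j by (intro eq_vecI) (auto simp: field_simps)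
    then show False using indep by blast
  qed
  then obtain i where i: "i < n" "\<phi> $ i * \<psi> $ j \<noteq> \<phi> $ j * \<psi> $ i" by blast
  \<comment> \<open>\<open>d\<close> is a nonzero 2 by 2 minor of the two functionals, and
    \<open>u\<close>, supported on the coordinates \<open>i\<close> and \<open>j\<close>, is the
    solution by Cramer's rule.\<close>
  define d where "d = \<phi> $ i * \<psi> $ j - \<phi> $ j * \<psi> $ i"
  have d: "d \<noteq> 0" using i by (simp add: d_def)
  define u where "u = (\<psi> $ j / d) \<cdot>\<^sub>v unit_vec n i + (- (\<psi> $ i / d)) \<cdot>\<^sub>v unit_vec n j"
  have uc: "u \<in> carrier_vec n" by (simp add: u_def)
  have val: "\<chi> \<bullet> u = (\<psi> $ j * \<chi> $ i - \<psi> $ i * \<chi> $ j) / d" if "\<chi> \<in> carrier_vec n" for \<chi>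
    using that i j
    by (simp add: u_def scalar_prod_add_distrib[of _ n] scalar_prod_right_unit diff_divide_distrib)
  have "\<psi> \<bullet> u = 0" using val[OF q] by simp
  moreover have "\<phi> \<bullet> u = 1" using val[OF p] d by (simp add: d_def mult.commute)
  ultimately show ?thesis using that uc by blast
qed

lemma addrow_mat_transv:
  "k < n \<Longrightarrow> l < n \<Longrightarrow> k \<noteq> l \<Longrightarrow> addrow_mat n a k l = transv (a \<cdot>\<^sub>v unit_vec n k) (unit_vec n l)"
  by (intro eq_matI) (auto simp: transv_def)

subsection \<open>The two generators\<close>

text \<open>Explicit lists let the simplifier evaluate products entry by entry while the entries
  stay symbolic.\<close>

definition lvec :: "'a list \<Rightarrow> 'a vec" where
  "lvec xs = vec (length xs) (\<lambda>i. xs ! i)"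

lemma dim_lvec [simp]: "dim_vec (lvec xs) = length xs"
  by (simp add: lvec_def)

lemma lvec_carrier [simp]: "lvec xs \<in> carrier_vec n \<longleftrightarrow> length xs = n"
  using carrier_dim_vec[of "lvec xs" n] by simp

lemma lvec_eq_iff [simp]: "lvec xs = lvec ys \<longleftrightarrow> xs = ys"
proof
  assume eq: "lvec xs = lvec ys"
  then have len: "length xs = length ys" by (metis dim_lvec)
  show "xs = ys"
  proof (rule nth_equalityI[OF len])
    fix i assume "i < length xs"
    moreover have "lvec xs $ i = lvec ys $ i" using eq by simp
    ultimately show "xs ! i = ys ! i" using len by (simp add: lvec_def)
  qed
qed simp

lemma lvec_add [simp]: "length xs = length ys \<Longrightarrow> lvec xs + lvec ys = lvec (map2 (+) xs ys)"
  by (intro eq_vecI) (auto simp: lvec_def)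

lemma lvec_smult [simp]: "c \<cdot>\<^sub>v lvec xs = lvec (map ((*) c) xs)"
  by (intro eq_vecI) (auto simp: lvec_def)

lemma lvec_scalar_prod [simp]:
  "length xs = length ys \<Longrightarrow> lvec xs \<bullet> lvec ys = sum_list (map2 (*) xs ys)"
  by (simp add: scalar_prod_def lvec_def sum_list_sum_nth)

lemma mat_of_rows_list_mult_lvec:
  "length xs = n \<Longrightarrow> \<forall>r\<in>set rs. length r = n \<Longrightarrow>
   mat_of_rows_list n rs *\<^sub>v lvec xs = lvec (map (\<lambda>r. sum_list (map2 (*) r xs)) rs)"
  by (intro eq_vecI) (auto simp: lvec_def mat_of_rows_list_def scalar_prod_def sum_list_sum_nth)

lemma transpose_mat_of_rows_list_mult_lvec:
  "length rs = length xs \<Longrightarrow>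
   (mat_of_rows_list n rs)\<^sup>T *\<^sub>v lvec xs
     = lvec (map (\<lambda>j. sum_list (map2 (\<lambda>r x. r ! j * x) rs xs)) [0..<n])"
  by (intro eq_vecI) (auto simp: lvec_def mat_of_rows_list_def scalar_prod_def sum_list_sum_nth)

lemma upt_12: "[0..<12] = [0, 1, 2, 3, 4, 5, 6, 7, 8, 9, 10, 11]"
  by (simp add: upt_rec)

lemma lvec12_cases:
  assumes "v \<in> carrier_vec 12"
  obtains a0 a1 a2 a3 a4 a5 a6 a7 a8 a9 a10 a11 where
    "v = lvec [a0, a1, a2, a3, a4, a5, a6, a7, a8, a9, a10, a11]"
proof -
  have "v = lvec (map (\<lambda>i. v $ i) [0..<12])"
    using assms by (intro eq_vecI) (auto simp: lvec_def)
  then show ?thesis using that by (simp add: upt_12)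
qed

section \<open>The two matrices and their action on vectors and functionals\<close>

definition X_rows :: "'a::field \<Rightarrow> 'a list list" where
  "X_rows t = [
    [- 1, 0, 0, 0, 0, t, 0, 0, 0, 0, 0, 0],
    [0, 0, 0, 0, 0, 0, - 1, 0, 0, 0, 0, 0],
    [0, 0, 0, 0, 0, 0, 0, 0, 0, 0, 0, - 1],
    [0, 0, 0, 0, 0, 0, 0, 0, 0, 1, 0, 0],
    [0, 0, 0, 0, 0, 0, 0, 1, 0, 0, 0, 0],
    [0, 0, 0, 0, 0, 1, 0, 0, 0, 0, 0, 0],
    [0, - 1, 0, 0, 0, 0, 0, 0, 0, 0, 0, 0],
    [0, 0, 0, 0, 1, 0, 0, 0, 0, 0, 0, 0],
    [0, 0, 0, 0, 0, 0, 0, 0, 1, 0, 0, 0],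
    [0, 0, 0, 1, 0, 0, 0, 0, 0, 0, 0, 0],
    [0, 0, 0, 0, 0, 0, 0, 0, 0, 0, - 1, 0],
    [0, 0, - 1, 0, 0, 0, 0, 0, 0, 0, 0, 0]]"

definition Y_rows :: "'a::field list list" where
  "Y_rows = [
    [0, 0, 0, 0, - 1, 0, 0, 0, 0, 0, 0, 0],
    [0, 0, 0, 0, 0, - 1, 0, 0, 0, 0, 0, 0],
    [0, 0, 0, 0, 0, 0, 0, 0, 0, 0, - 1, 0],
    [0, 0, 0, 0, 0, 0, 0, 0, 1, 0, 0, 0],
    [0, 0, 0, 0, 0, 0, 1, 0, 0, 0, 0, 0],
    [0, 0, 0, 0, 0, 0, 0, 0, 0, 0, 0, 1],
    [- 1, 0, 0, 0, 0, 0, 0, 0, 0, 0, 0, 0],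
    [0, 0, 0, 1, 0, 0, 0, 0, 0, 0, 0, 0],
    [0, 0, 0, 0, 0, 0, 0, 1, 0, 0, 0, 0],
    [0, 0, 1, 0, 0, 0, 0, 0, 0, 0, 0, 0],
    [0, 0, 0, 0, 0, 0, 0, 0, 0, - 1, 0, 0],
    [0, - 1, 0, 0, 0, 0, 0, 0, 0, 0, 0, 0]]"

definition X :: "'a::field \<Rightarrow> 'a mat" where
  "X t = mat_of_rows_list 12 (X_rows t)"

definition Y :: "'a::field mat" where
  "Y = mat_of_rows_list 12 Y_rows"

lemma X_carrier [simp]: "X t \<in> carrier_mat 12 12"
  by (rule carrier_matI) (simp_all add: X_def X_rows_def mat_of_rows_list_def)

lemma Y_carrier [simp]: "Y \<in> carrier_mat 12 12"
  by (rule carrier_matI) (simp_all add: Y_def Y_rows_def mat_of_rows_list_def)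

lemma X_mult:
  "X t *\<^sub>v lvec [a0, a1, a2, a3, a4, a5, a6, a7, a8, a9, a10, a11] =
   lvec [- a0 + t * a5, - a6, - a11, a9, a7, a5, - a1, a4, a8, a3, - a10, - a2]"
  using mat_of_rows_list_mult_lvec[of "[a0, a1, a2, a3, a4, a5, a6, a7, a8, a9, a10, a11]" 12 "X_rows t"]
  by (simp add: X_def X_rows_def algebra_simps)

lemma Y_mult:
  "Y *\<^sub>v lvec [a0, a1, a2, a3, a4, a5, a6, a7, a8, a9, a10, a11] =
   lvec [- a4, - a5, - a10, a8, a6, a11, - a0, a3, a7, a2, - a9, - a1]"
  using mat_of_rows_list_mult_lvec[of "[a0, a1, a2, a3, a4, a5, a6, a7, a8, a9, a10, a11]" 12 "Y_rows"]
  by (simp add: Y_def Y_rows_def)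

lemma X_transpose_mult:
  "(X t)\<^sup>T *\<^sub>v lvec [w0, w1, w2, w3, w4, w5, w6, w7, w8, w9, w10, w11] =
   lvec [- w0, - w6, - w11, w9, w7, w5 + t * w0, - w1, w4, w8, w3, - w10, - w2]"
  using transpose_mat_of_rows_list_mult_lvec[of "X_rows t" "[w0, w1, w2, w3, w4, w5, w6, w7, w8, w9, w10, w11]" 12]
  by (simp add: X_def X_rows_def upt_12 algebra_simps)

lemma Y_transpose_mult:
  "Y\<^sup>T *\<^sub>v lvec [w0, w1, w2, w3, w4, w5, w6, w7, w8, w9, w10, w11] =
   lvec [- w6, - w11, w9, w7, - w0, - w1, w4, w8, w3, - w10, - w2, w5]"
  using transpose_mat_of_rows_list_mult_lvec[of "Y_rows" "[w0, w1, w2, w3, w4, w5, w6, w7, w8, w9, w10, w11]" 12]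
  by (simp add: Y_def Y_rows_def upt_12)

text \<open>Powers are evaluated by iteration on a vector, so that no symbolic 12 by 12 power has to
  be formed.\<close>

lemma pow_mat_mult_vec:
  assumes A: "A \<in> carrier_mat n n" and v: "v \<in> carrier_vec n"
  shows "(A ^\<^sub>m k) *\<^sub>v v = (((*\<^sub>v) A) ^^ k) v"
  using v
proof (induction k arbitrary: v)
  case (Suc k)
  have "(A ^\<^sub>m Suc k) *\<^sub>v v = (A ^\<^sub>m k) *\<^sub>v (A *\<^sub>v v)"
    using A Suc.prems by (simp add: assoc_mult_mat_vec[of _ n n _ n])
  also have "\<dots> = (((*\<^sub>v) A) ^^ k) (A *\<^sub>v v)"
    using Suc.IH[of "A *\<^sub>v v"] A Suc.prems by auto
  finally show ?case by (simp add: funpow_swap1)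
qed (use A in auto)

lemma det_pow_mat: "A \<in> carrier_mat n n \<Longrightarrow> det (A ^\<^sub>m k) = det A ^ k"
proof (induction k)
  case (Suc k)
  then show ?case using det_mult[of "A ^\<^sub>m k" n A] by (simp add: mult.commute)
qed simp

lemma X_mult_X: "X t * X t = 1\<^sub>m 12"
proof (rule mat_eq_if_mult_vec_eq[of _ 12])
  fix v :: "'a vec" assume "v \<in> carrier_vec 12"
  then show "X t * X t *\<^sub>v v = 1\<^sub>m 12 *\<^sub>v v"
    by (cases v rule: lvec12_cases) (simp_all add: assoc_mult_mat_vec[of _ 12 12 _ 12] X_mult)
qed (auto intro: mult_carrier_mat[of _ 12 12])

lemma Y_mult_Y_mult_Y: "Y * Y * Y = (1\<^sub>m 12 :: 'a::field mat)"
proof (rule mat_eq_if_mult_vec_eq[of _ 12])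
  fix v :: "'a vec" assume "v \<in> carrier_vec 12"
  then show "Y * Y * Y *\<^sub>v v = 1\<^sub>m 12 *\<^sub>v v"
    by (cases v rule: lvec12_cases)
      (simp_all add: assoc_mult_mat_vec[of _ 12 12 _ 12] Y_mult mult_carrier_mat[of _ 12 12])
qed (auto intro!: mult_carrier_mat[of _ 12 12])

lemma XY_mult:
  "(X t * Y) *\<^sub>v lvec [a0, a1, a2, a3, a4, a5, a6, a7, a8, a9, a10, a11] =
   lvec [a4 + t * a11, a0, a1, a2, a3, a11, a5, a6, a7, a8, a9, a10]"
  by (simp add: assoc_mult_mat_vec[of _ 12 12 _ 12] X_mult Y_mult algebra_simps)

text \<open>After five steps the 5-cycle is back at its start, so the first five coordinates change
  only by multiples of \<open>t\<close>, while the 7-cycle is rotated.\<close>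

lemma XY_pow_5_mult:
  "(((*\<^sub>v) (X t * Y)) ^^ 5) (lvec [a0, a1, a2, a3, a4, a5, a6, a7, a8, a9, a10, a11]) =
   lvec [a0 + t * a7, a1 + t * a8, a2 + t * a9, a3 + t * a10, a4 + t * a11, a7, a8, a9, a10, a11, a5, a6]"
  by (simp add: numeral_eq_Suc XY_mult)

definition svec :: "'a::field vec" where
  "svec = lvec [1, 1, 1, 1, 1, 0, 0, 0, 0, 0, 0, 0]"

lemma svec_carrier [simp]: "svec \<in> carrier_vec 12"
  by (simp add: svec_def)

definition \<sigma> :: "'a::field vec" where
  "\<sigma> = lvec [0, 0, 0, 0, 0, 1, 1, 1, 1, 1, 1, 1]"

text \<open>
  In the chosen basis \<^term>\<open>X t * Y\<close> is a 5-cycle and a 7-cycle coupled by a single entry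
  \<^term>\<open>t\<close>. Since 5 and 7 are coprime, each of the 35 products of a power of one cycle with
  a power of the other contributes once, so that no integer factor appears in the transvection.
\<close>

lemma funpow_7: "(f ^^ 7) x = f (f (f (f (f (f (f x))))))"
  by (simp add: numeral_eq_Suc)

lemma XY_pow_35: "(X t * Y) ^\<^sub>m 35 = transv (t \<cdot>\<^sub>v svec) \<sigma>"
proof (rule mat_eq_if_mult_vec_eq[of _ 12])
  have XY: "X t * Y \<in> carrier_mat 12 12" by (rule mult_carrier_mat[of _ 12 12]) auto
  then show "(X t * Y) ^\<^sub>m 35 \<in> carrier_mat 12 12" by simp
  fix v :: "'a vec" assume v: "v \<in> carrier_vec 12"
  have "(X t * Y) ^\<^sub>m 35 *\<^sub>v v = ((((*\<^sub>v) (X t * Y)) ^^ 5) ^^ 7) v"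
    using pow_mat_mult_vec[OF XY v] by (simp add: funpow_mult)
  also have "\<dots> = v + (\<sigma> \<bullet> v) \<cdot>\<^sub>v (t \<cdot>\<^sub>v svec)"
    using v
  proof (cases v rule: lvec12_cases)
    case 1
    show ?thesis
      unfolding 1 by (simp add: funpow_7 XY_pow_5_mult svec_def \<sigma>_def) (simp add: algebra_simps)
  qed
  also have "\<dots> = transv (t \<cdot>\<^sub>v svec) \<sigma> *\<^sub>v v"
    using v by (subst transv_mult_vec[of _ 12]) (auto simp: svec_def \<sigma>_def)
  finally show "(X t * Y) ^\<^sub>m 35 *\<^sub>v v = transv (t \<cdot>\<^sub>v svec) \<sigma> *\<^sub>v v" .
qed (simp add: svec_def)

lemma det_transv_svec_\<sigma>: "det (transv (t \<cdot>\<^sub>v svec) \<sigma> :: 'a::field mat) = 1"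
proof -
  let ?T = "transv (t \<cdot>\<^sub>v svec) \<sigma> :: 'a mat"
  have T: "?T \<in> carrier_mat 12 12" by (simp add: svec_def)
  have e: "?T $$ (i, j) = (if i = j then 1 else 0) + (if i < 5 \<and> 5 \<le> j then t else 0)"
    if "i < 12" "j < 12" for i j
  proof -
    have s: "svec $ i = (if i < 5 then 1 else 0 :: 'a)" if "i < 12" for i
      using that by (auto simp: svec_def lvec_def less_Suc_eq numeral_eq_Suc)
    have "\<sigma> $ j = (if 5 \<le> j then 1 else 0 :: 'a)"
      using that(2) by (auto simp: \<sigma>_def lvec_def less_Suc_eq numeral_eq_Suc)
    then show ?thesis using that s by (simp add: transv_def carrier_vecD[OF svec_carrier])
  qed
  \<comment> \<open>The support of \<open>svec\<close> precedes that of \<open>\<sigma>\<close>, so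
    the rank one part lies strictly above the diagonal.\<close>
  have "upper_triangular ?T" using e carrier_matD(1)[OF T] by (auto simp: upper_triangular_def)
  then have "det ?T = prod_list (diag_mat ?T)" using det_upper_triangular T by blast
  also have "\<dots> = (\<Prod>i = 0..<12. ?T $$ (i, i))" using carrier_matD(1)[OF T] by (simp add: prod_list_diag_prod)
  also have "\<dots> = 1" by (rule prod.neutral) (auto simp: e)
  finally show ?thesis .
qed

text \<open>No determinant of \<open>X t\<close> or \<open>Y\<close> is expanded. With x^2 = y^3 =
  1, the power (xy)^35 reduces to x y^2, because 35 is 1 modulo 2 and 2 modulo 3; it equals 1
  because (XY)^35 is a transvection. So x = y, and both are 1.\<close>

lemma det_X_Y: "det (X t) = (1 :: 'a::field)" "det Y = (1 :: 'a)"
proof -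
  let ?x = "det (X t) :: 'a" and ?y = "det Y :: 'a"
  have x: "?x * ?x = 1"
    using det_mult[of "X t" 12 "X t"] by (simp add: X_mult_X)
  have y: "?y * ?y * ?y = 1"
    using det_mult[of "Y * Y" 12 "Y :: 'a mat"] det_mult[of Y 12 "Y :: 'a mat"]
    by (simp add: Y_mult_Y_mult_Y mult_carrier_mat[of _ 12 12])
  have "(?x * ?y) ^ 35 = 1"
    using det_pow_mat[of "X t * Y" 12 35] det_mult[of "X t" 12 Y]
    by (simp add: XY_pow_35 det_transv_svec_\<sigma> mult_carrier_mat[of _ 12 12])
  moreover have "(?x * ?y) ^ 35 = (?x * ?x) ^ 17 * ?x * ((?y * ?y * ?y) ^ 11 * (?y * ?y))"
    by (simp add: power_mult_distrib power_numeral_reduce algebra_simps)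
  ultimately have xyy: "?x * (?y * ?y) = 1" using x y by simp
  have "?x = ?x * (?y * ?y) * ?y" using y by (simp add: mult.assoc)
  then have xy: "?x = ?y" using xyy by simp
  show "?x = 1" using x y xy by simp
  then show "?y = 1" using xy by simp
qed

subsection \<open>Transvections in the generated group\<close>

definition H :: "'a::{field,finite} \<Rightarrow> 'a mat set" where
  "H t = generate (SL 12 TYPE('a)) {X t, Y}"

lemma X_Y_in_SL: "X t \<in> carrier (SL 12 TYPE('a::{field,finite}))" "Y \<in> carrier (SL 12 TYPE('a))"
  by (auto simp: SL_def det_X_Y)

lemma subgroup_H: "subgroup (H t) (SL 12 TYPE('a::{field,finite}))"
  unfolding H_def by (rule group.generate_is_subgroup[OF group_SL]) (use X_Y_in_SL in auto)

lemma H_carrier: "A \<in> H t \<Longrightarrow> A \<in> carrier_mat 12 12"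
  using subgroup.subset[OF subgroup_H[of t]] by (auto simp: SL_def)

lemma H_mult: "A \<in> H t \<Longrightarrow> B \<in> H t \<Longrightarrow> A * B \<in> H t"
  using subgroup.m_closed[OF subgroup_H[of t], of A B] by (simp add: SL_def)

lemma H_one: "1\<^sub>m 12 \<in> H t"
  using subgroup.one_closed[OF subgroup_H[of t]] by (simp add: SL_def)

lemma X_in_H: "X t \<in> H t" and Y_in_H: "Y \<in> H t"
  by (auto simp: H_def intro: generate.incl)

lemma H_inverse:
  assumes "A \<in> H t" and "B \<in> carrier_mat 12 12" and "B * A = 1\<^sub>m 12"
  shows "B \<in> H t"
proof -
  have A: "A \<in> carrier (SL 12 TYPE('a))" using subgroup.subset[OF subgroup_H] assms(1) by blast
  then have "A \<in> carrier_mat 12 12" "det A = 1" by (auto simp: SL_def)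
  then have "det B = 1" using det_mult[of B 12 A] assms by simp
  then have "inv\<^bsub>SL 12 TYPE('a)\<^esub> A = B"
    using assms A by (intro group.inv_equality[OF group_SL]) (auto simp: SL_def)
  then show ?thesis using subgroup.m_inv_closed[OF subgroup_H assms(1)] by simp
qed

definition tv :: "'a::{field,finite} \<Rightarrow> 'a vec \<Rightarrow> 'a vec \<Rightarrow> bool" where
  "tv t u \<phi> \<longleftrightarrow> u \<in> carrier_vec 12 \<and> \<phi> \<in> carrier_vec 12 \<and> \<phi> \<bullet> u = 0 \<and> transv u \<phi> \<in> H t"

lemma tv_carrier: "tv t u \<phi> \<Longrightarrow> u \<in> carrier_vec 12" "tv t u \<phi> \<Longrightarrow> \<phi> \<in> carrier_vec 12"
  by (auto simp: tv_def)

lemma tv_zero: "\<phi> \<in> carrier_vec 12 \<Longrightarrow> tv t (0\<^sub>v 12) \<phi>"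
  by (simp add: tv_def H_one)

lemma tv_add: "tv t u \<phi> \<Longrightarrow> tv t v \<phi> \<Longrightarrow> tv t (u + v) \<phi>"
  using H_mult[of "transv u \<phi>" t "transv v \<phi>"]
  by (auto simp: tv_def transv_mult_transv[of _ 12] scalar_prod_add_distrib[of _ 12])

lemma tv_uminus:
  assumes "tv t u \<phi>"
  shows "tv t (- u) \<phi>"
proof -
  have *: "u \<in> carrier_vec 12" "\<phi> \<in> carrier_vec 12" "\<phi> \<bullet> u = 0" using assms by (auto simp: tv_def)
  have "transv (- u) \<phi> * transv u \<phi> = transv (- u + u) \<phi>"
    using * by (intro transv_mult_transv[of _ 12]) auto
  also have "- u + u = 0\<^sub>v 12" using * by simp
  finally have "transv (- u) \<phi> * transv u \<phi> = 1\<^sub>m 12" by simp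
  moreover have "transv u \<phi> \<in> H t" using assms by (simp add: tv_def)
  moreover have "transv (- u) \<phi> \<in> carrier_mat 12 12" using *(1) by (intro transv_carrier) simp
  ultimately have "transv (- u) \<phi> \<in> H t" using H_inverse by blast
  then show ?thesis using * by (simp add: tv_def)
qed

lemma tv_conjugate:
  assumes tv: "tv t u \<phi>" and A: "A \<in> H t" and B: "B \<in> H t"
    and AB: "A * B = 1\<^sub>m 12"
  shows "tv t (A *\<^sub>v u) (B\<^sup>T *\<^sub>v \<phi>)"
proof -
  have *: "u \<in> carrier_vec 12" "\<phi> \<in> carrier_vec 12" "\<phi> \<bullet> u = 0" "transv u \<phi> \<in> H t"
    using tv by (auto simp: tv_def)
  have c: "A \<in> carrier_mat 12 12" "B \<in> carrier_mat 12 12" using A B H_carrier by auto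
  have BA: "B * A = 1\<^sub>m 12" using mat_mult_left_right_inverse[OF c AB] .
  have "(B\<^sup>T *\<^sub>v \<phi>) \<bullet> (A *\<^sub>v u) = \<phi> \<bullet> (B *\<^sub>v (A *\<^sub>v u))"
    using transpose_vec_mult_scalar[OF c(2) _ *(2), of "A *\<^sub>v u"] c * by auto
  also have "B *\<^sub>v (A *\<^sub>v u) = u"
    using c * BA by (simp flip: assoc_mult_mat_vec)
  finally have "(B\<^sup>T *\<^sub>v \<phi>) \<bullet> (A *\<^sub>v u) = 0" using * by simp
  moreover have "transv (A *\<^sub>v u) (B\<^sup>T *\<^sub>v \<phi>) \<in> H t"
    using conjugate_transv[OF c AB *(1,2)] H_mult[OF H_mult[OF A *(4)] B] by simp
  ultimately show ?thesis using c * by (auto simp: tv_def)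
qed

text \<open>This is the commutator of the two transvections: conjugation by T(v, psi) fixes phi, as
  phi(v) = 0, and moves u to u + psi(u) v. Multiplying by T(-u, phi) leaves the
  displacement.\<close>

lemma tv_commutator:
  assumes u: "tv t u \<phi>" and v: "tv t v \<psi>" and "\<phi> \<bullet> v = 0"
  shows "tv t ((\<psi> \<bullet> u) \<cdot>\<^sub>v v) \<phi>"
proof -
  have *: "u \<in> carrier_vec 12" "\<phi> \<in> carrier_vec 12" "\<phi> \<bullet> u = 0"
    "v \<in> carrier_vec 12" "\<psi> \<in> carrier_vec 12" "\<psi> \<bullet> v = 0"
    using u v by (auto simp: tv_def)
  define A where "A = transv v \<psi>"
  define B where "B = transv (- v) \<psi>"
  have H: "A \<in> H t" "B \<in> H t" using v tv_uminus[OF v] by (auto simp: tv_def A_def B_def)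
  have AB: "A * B = 1\<^sub>m 12"
    using * transv_mult_transv[of v 12 "- v" \<psi>] uminus_r_inv_vec[of v 12] by (simp add: A_def B_def)
  have Au: "A *\<^sub>v u = u + (\<psi> \<bullet> u) \<cdot>\<^sub>v v" using * by (simp add: A_def transv_mult_vec[of _ 12])
  have "B\<^sup>T *\<^sub>v \<phi> = \<phi>"
  proof -
    have "B\<^sup>T *\<^sub>v \<phi> = \<phi> + 0 \<cdot>\<^sub>v \<psi>"
      using * assms(3) comm_scalar_prod[of \<phi> 12 v]
      by (simp add: B_def transpose_transv[of _ 12] transv_mult_vec[of _ 12])
    then show ?thesis using * by (auto intro!: eq_vecI)
  qed
  then have "tv t (u + (\<psi> \<bullet> u) \<cdot>\<^sub>v v) \<phi>"
    using tv_conjugate[OF u H AB] Au by simp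
  from tv_add[OF this tv_uminus[OF u]] show ?thesis
    using * by (simp add: algebra_simps comm_add_vec[of u 12] assoc_add_vec[of _ 12])
qed

text \<open>A commutator yields only the particular multiple psi(u) v; once a whole line is
  available, such factors can be absorbed.\<close>

definition full :: "'a::{field,finite} \<Rightarrow> 'a vec \<Rightarrow> 'a vec \<Rightarrow> bool" where
  "full t u \<phi> \<longleftrightarrow> (\<forall>c. tv t (c \<cdot>\<^sub>v u) \<phi>)"

lemma full_imp_tv: "full t u \<phi> \<Longrightarrow> tv t u \<phi>"
  unfolding full_def by (metis one_smult_vec)

lemma full_carrier:
  assumes "full t u \<phi>"
  shows "u \<in> carrier_vec 12" "\<phi> \<in> carrier_vec 12" "\<phi> \<bullet> u = 0"
  using full_imp_tv[OF assms] by (auto simp: tv_def)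

lemma full_smult: "full t u \<phi> \<Longrightarrow> full t (c \<cdot>\<^sub>v u) \<phi>"
  by (simp add: full_def smult_smult_assoc)

lemma full_add:
  assumes "full t u \<phi>" and "full t v \<phi>"
  shows "full t (u + v) \<phi>"
  using assms full_carrier[OF assms(1)] full_carrier[OF assms(2)]
  by (auto simp: full_def smult_add_distrib_vec[of _ 12] intro: tv_add)

lemma full_conjugate:
  assumes f: "full t u \<phi>" and A: "A \<in> H t" and B: "B \<in> H t" and AB: "A * B = 1\<^sub>m 12"
  shows "full t (A *\<^sub>v u) (B\<^sup>T *\<^sub>v \<phi>)"
  using tv_conjugate[OF _ A B AB] f full_carrier[OF f] H_carrier[OF A]
  by (simp add: full_def flip: mult_mat_vec[of A 12 12])

text \<open>Rescaling \<open>u\<close> by c / psi(u) makes the commutator produce c v. The scalars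
  thus pass from \<open>u\<close> to \<open>v\<close>, although only one transvection at
  \<open>v\<close> is given.\<close>

lemma full_commutator:
  assumes u: "full t u \<phi>" and v: "tv t v \<psi>" and "\<phi> \<bullet> v = 0" and ne: "\<psi> \<bullet> u \<noteq> 0"
  shows "full t v \<phi>"
  unfolding full_def
proof
  fix c
  have "tv t ((c / (\<psi> \<bullet> u)) \<cdot>\<^sub>v u) \<phi>" using u by (simp add: full_def)
  from tv_commutator[OF this v assms(3)] show "tv t (c \<cdot>\<^sub>v v) \<phi>"
    using ne full_carrier[OF u] tv_carrier[OF v] by simp
qed

text \<open>\<open>Y * Y\<close> is the inverse of \<open>Y\<close>. As a signed permutation matrix
  \<open>Y\<close> is orthogonal, so functionals move by the same formula as vectors.\<close>

lemma Y_inverse_transpose: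
  "(Y * Y)\<^sup>T *\<^sub>v lvec [w0, w1, w2, w3, w4, w5, w6, w7, w8, w9, w10, w11] =
   lvec [- w4, - w5, - w10, w8, w6, w11, - w0, w3, w7, w2, - w9, - w1]"
  by (simp add: transpose_mult[of _ 12 12 _ 12] assoc_mult_mat_vec[of _ 12 12 _ 12] Y_transpose_mult)

lemma Y_mult_YY: "Y * (Y * Y) = (1\<^sub>m 12 :: 'a::field mat)"
  using Y_mult_Y_mult_Y by (simp add: assoc_mult_mat[of _ 12 12 _ 12 _ 12])

lemma tv_X:
  "tv t (lvec [a0, a1, a2, a3, a4, a5, a6, a7, a8, a9, a10, a11]) (lvec [w0, w1, w2, w3, w4, w5, w6, w7, w8, w9, w10, w11]) \<Longrightarrow>
   tv t (lvec [- a0 + t * a5, - a6, - a11, a9, a7, a5, - a1, a4, a8, a3, - a10, - a2])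
        (lvec [- w0, - w6, - w11, w9, w7, w5 + t * w0, - w1, w4, w8, w3, - w10, - w2])"
  using tv_conjugate[OF _ X_in_H X_in_H X_mult_X] by (fastforce simp: X_mult X_transpose_mult)

lemma tv_Y:
  "tv t (lvec [a0, a1, a2, a3, a4, a5, a6, a7, a8, a9, a10, a11]) (lvec [w0, w1, w2, w3, w4, w5, w6, w7, w8, w9, w10, w11]) \<Longrightarrow>
   tv t (lvec [- a4, - a5, - a10, a8, a6, a11, - a0, a3, a7, a2, - a9, - a1])
        (lvec [- w4, - w5, - w10, w8, w6, w11, - w0, w3, w7, w2, - w9, - w1])"
  using tv_conjugate[OF _ Y_in_H H_mult[OF Y_in_H Y_in_H] Y_mult_YY]
  by (fastforce simp: Y_mult Y_inverse_transpose)

lemma full_X: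
  "full t (lvec [a0, a1, a2, a3, a4, a5, a6, a7, a8, a9, a10, a11]) (lvec [w0, w1, w2, w3, w4, w5, w6, w7, w8, w9, w10, w11]) \<Longrightarrow>
   full t (lvec [- a0 + t * a5, - a6, - a11, a9, a7, a5, - a1, a4, a8, a3, - a10, - a2])
          (lvec [- w0, - w6, - w11, w9, w7, w5 + t * w0, - w1, w4, w8, w3, - w10, - w2])"
  using full_conjugate[OF _ X_in_H X_in_H X_mult_X] by (fastforce simp: X_mult X_transpose_mult)

lemma full_Y:
  "full t (lvec [a0, a1, a2, a3, a4, a5, a6, a7, a8, a9, a10, a11]) (lvec [w0, w1, w2, w3, w4, w5, w6, w7, w8, w9, w10, w11]) \<Longrightarrow>
   full t (lvec [- a4, - a5, - a10, a8, a6, a11, - a0, a3, a7, a2, - a9, - a1])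
          (lvec [- w4, - w5, - w10, w8, w6, w11, - w0, w3, w7, w2, - w9, - w1])"
  using full_conjugate[OF _ Y_in_H H_mult[OF Y_in_H Y_in_H] Y_mult_YY]
  by (fastforce simp: Y_mult Y_inverse_transpose)

lemma XY_pow_in_H: "(X t * Y) ^\<^sub>m k \<in> H t"
proof (induction k)
  case 0
  have "dim_row (X t * Y) = 12" using carrier_matD(1)[OF X_carrier[of t]] by simp
  then show ?case by (simp add: H_one)
next
  case (Suc k)
  then show ?case by (simp add: H_mult X_in_H Y_in_H)
qed

lemma tv_svec: "tv t (lvec [t, t, t, t, t, 0, 0, 0, 0, 0, 0, 0]) \<sigma>"
  using XY_pow_in_H[of t 35] by (simp add: XY_pow_35 tv_def svec_def \<sigma>_def)

subsection \<open>Transvections with a fixed functional\<close>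

text \<open>Conjugation by XY and its inverse preserves \<open>\<sigma>\<close>, in accordance with
  XY commuting with its own 35th power. Applying \<open>Y\<close> twice stands for the inverse of
  \<open>Y\<close>.\<close>

lemma tv_XY_inverse:
  "tv t (lvec [a0, a1, a2, a3, a4, a5, a6, a7, a8, a9, a10, a11]) \<sigma> \<Longrightarrow>
   tv t (lvec [a1, a2, a3, a4, a0 - t * a5, a6, a7, a8, a9, a10, a11, a5]) \<sigma>"
  unfolding \<sigma>_def by (drule tv_X, drule tv_Y, drule tv_Y) (simp add: algebra_simps)

lemma full_XY:
  "full t (lvec [a0, a1, a2, a3, a4, a5, a6, a7, a8, a9, a10, a11]) \<sigma> \<Longrightarrow>
   full t (lvec [a4 + t * a11, a0, a1, a2, a3, a11, a5, a6, a7, a8, a9, a10]) \<sigma>"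
  unfolding \<sigma>_def by (drule full_Y, drule full_X) (simp add: algebra_simps)

lemma full_XY_inverse:
  "full t (lvec [a0, a1, a2, a3, a4, a5, a6, a7, a8, a9, a10, a11]) \<sigma> \<Longrightarrow>
   full t (lvec [a1, a2, a3, a4, a0 - t * a5, a6, a7, a8, a9, a10, a11, a5]) \<sigma>"
  unfolding \<sigma>_def by (drule full_X, drule full_Y, drule full_Y) (simp add: algebra_simps)

lemma tv_f:
  "tv t (lvec [- t, 0, 0, 0, 0, 0, - t, t, 0, t, 0, - t])
     (lvec [0, - 1, - 1, 1, 1, 1, 0, 0, 1, 0, - 1, 0])"
proof -
  show ?thesis
    using tv_X[OF tv_svec[unfolded \<sigma>_def]] by (simp add: algebra_simps)
qed

text \<open>This is the conjugate of \<open>tv_svec\<close> by the word Y X Y X Y X Y^2 X Y^2,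
  applied letter by letter from the right.\<close>

lemma tv_g:
  "tv t (lvec [- t, 0, 0, 0, 0, - t, t, 0, t, t * t, - t * t, - t])
     (lvec [- t, 1, 1, - 1, - 1, 0, 0, - 1, - t, 1, 1, 0])"
proof -
  have s0: "tv t (lvec [- t, 0, 0, 0, 0, 0, - t, t, 0, t, 0, - t])
      (lvec [0, - 1, - 1, 1, 1, 1, 0, 0, 1, 0, - 1, 0])"
    using tv_Y[OF tv_svec[unfolded \<sigma>_def]] by (simp add: algebra_simps)
  have s1: "tv t (lvec [0, 0, 0, 0, - t, - t, t, 0, t, 0, - t, 0])
      (lvec [- 1, - 1, 1, 1, 0, 0, 0, 1, 0, - 1, 0, 1])"
    using tv_Y[OF s0] by (simp add: algebra_simps)
  have s2: "tv t (lvec [- t * t, - t, 0, 0, 0, - t, 0, - t, t, 0, t, 0])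
      (lvec [1, 0, - 1, - 1, 1, - t, 1, 0, 0, 1, 0, - 1])"
    using tv_X[OF s1] by (simp add: algebra_simps)
  have s3: "tv t (lvec [0, t, - t, t, 0, 0, t * t, 0, - t, 0, 0, t])
      (lvec [- 1, t, 0, 0, 1, - 1, - 1, - 1, 0, - 1, - 1, 0])"
    using tv_Y[OF s2] by (simp add: algebra_simps)
  have s4: "tv t (lvec [0, 0, 0, - t, t * t, t, 0, t, 0, - t, 0, - t])
      (lvec [- 1, 1, 1, 0, - 1, 0, 1, 0, - 1, 0, 1, - t])"
    using tv_Y[OF s3] by (simp add: algebra_simps)
  have s5: "tv t (lvec [t * t, 0, t, - t, t, t, 0, t * t, 0, - t, 0, 0])
      (lvec [1, - 1, t, 0, 0, - t, - 1, - 1, - 1, 0, - 1, - 1])"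
    using tv_X[OF s4] by (simp add: algebra_simps)
  have s6: "tv t (lvec [- t, - t, 0, 0, 0, 0, - t * t, - t, t * t, t, t, 0])
      (lvec [0, t, 1, - 1, - 1, - 1, - 1, 0, - 1, t, 0, 1])"
    using tv_Y[OF s5] by (simp add: algebra_simps)
  have s7: "tv t (lvec [t, t * t, 0, t, - t, 0, t, 0, t * t, 0, - t, 0])
      (lvec [0, 1, - 1, t, 0, - 1, - t, - 1, - 1, - 1, 0, - 1])"
    using tv_X[OF s6] by (simp add: algebra_simps)
  have s8: "tv t (lvec [t, 0, t, t * t, t, 0, - t, t, 0, 0, 0, - t * t])
      (lvec [0, 1, 0, - 1, - t, - 1, 0, t, - 1, - 1, 1, - 1])"
    using tv_Y[OF s7] by (simp add: algebra_simps)
  have s9: "tv t (lvec [- t, t, t * t, 0, t, 0, 0, t, 0, t * t, 0, - t])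
      (lvec [0, 0, 1, - 1, t, - 1, - 1, - t, - 1, - 1, - 1, 0])"
    using tv_X[OF s8] by (simp add: algebra_simps)
  show ?thesis
    using tv_Y[OF s9] by (simp add: algebra_simps)
qed

text \<open>The functional of \<open>tv_f\<close> vanishes on \<open>svec\<close>, so a direct
  commutator is trivial. The detour goes through the vector of \<open>tv_g\<close>: the two pairings
  are -t^2 and -t^4, and both are units when \<open>t\<close> is.\<close>

lemma tv_multiple_f: "tv t (lvec [t * t * t * t * t, 0, 0, 0, 0, 0, t * t * t * t * t, - t * t * t * t * t, 0, - t * t * t * t * t, 0, t * t * t * t * t]) \<sigma>"
proof -
  have "tv t (lvec [t * t * t, 0, 0, 0, 0, t * t * t, - t * t * t, 0, - t * t * t, - t * t * t * t, t * t * t * t, t * t * t]) \<sigma>"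
    using tv_commutator[OF tv_svec tv_g] by (simp add: \<sigma>_def algebra_simps)
  from tv_commutator[OF this tv_f] show ?thesis by (simp add: \<sigma>_def algebra_simps)
qed

text \<open>This is the loop that multiplies by \<open>t\<close>: after three steps of the inverse
  of XY, the functional of \<open>tv_f\<close> takes the value \<open>c\<close>, and the vector of
  \<open>tv_f\<close> itself contributes the factor \<open>t\<close>.\<close>

lemma tv_f_step:
  assumes "tv t (lvec [- c, 0, 0, 0, 0, 0, - c, c, 0, c, 0, - c]) \<sigma>"
  shows "tv t (lvec [- (t * c), 0, 0, 0, 0, 0, - (t * c), (t * c), 0, (t * c), 0, - (t * c)]) \<sigma>"
proof -
  have "tv t (lvec [0, 0, - c, c * (t), c * (- t), 0, c, 0, - c, 0, - c, c]) \<sigma>"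
    using tv_XY_inverse[OF tv_XY_inverse[OF tv_XY_inverse[OF assms]]] by (simp add: algebra_simps)
  from tv_commutator[OF this tv_f] show ?thesis by (simp add: \<sigma>_def algebra_simps)
qed

section \<open>Whole lines of vectors for the functional \<open>\<sigma>\<close>\<close>

lemma full_f:
  assumes "t \<noteq> 0" and gen: "\<And>c. c \<noteq> 0 \<Longrightarrow> \<exists>k::nat. c = t ^ k"
  shows "full t (lvec [- 1, 0, 0, 0, 0, 0, - 1, 1, 0, 1, 0, - 1]) \<sigma>"
proof -
  \<comment> \<open>The initial scalar -t^5 is the one supplied by \<open>tv_multiple_f\<close>.
    Since \<open>t\<close> generates the multiplicative group, its products with powers of
    \<open>t\<close> exhaust the nonzero scalars.\<close>
  have pow: "tv t (lvec [- c, 0, 0, 0, 0, 0, - c, c, 0, c, 0, - c]) \<sigma>" if "c = t ^ k * - (t ^ 5)" for k c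
    using that
  proof (induction k arbitrary: c)
    case 0
    then show ?case using tv_multiple_f[of t] by (simp add: numeral_eq_Suc mult.assoc)
  next
    case (Suc k)
    then show ?case using tv_f_step[OF Suc.IH[OF refl]] by (simp add: mult.assoc)
  qed
  have "tv t (lvec [- c, 0, 0, 0, 0, 0, - c, c, 0, c, 0, - c]) \<sigma>" for c
  proof (cases "c = 0")
    case True
    have "lvec [0, 0, 0, 0, 0, 0, 0, 0, 0, 0, 0, 0] = (0\<^sub>v 12 :: 'a vec)"
      by (rule eq_vecI) (auto simp: lvec_def less_Suc_eq numeral_eq_Suc)
    then show ?thesis using True tv_zero[of \<sigma> t] by (simp add: \<sigma>_def)
  next
    case False
    then obtain k where k: "c / - (t ^ 5) = t ^ k" using gen[of "c / - (t ^ 5)"] \<open>t \<noteq> 0\<close> by auto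
    have "c = c / - (t ^ 5) * - (t ^ 5)" using \<open>t \<noteq> 0\<close> by simp
    then show ?thesis unfolding k by (rule pow)
  qed
  then show ?thesis by (simp add: full_def)
qed

text \<open>The functional of \<open>tv_g\<close> takes the value \<open>t\<close> on the vector of
  \<open>f\<close>, so the lines carry over.\<close>

lemma full_g:
  assumes t: "t \<noteq> 0" and f: "full t (lvec [- 1, 0, 0, 0, 0, 0, - 1, 1, 0, 1, 0, - 1]) \<sigma>"
  shows "full t (lvec [- 1, 0, 0, 0, 0, - 1, 1, 0, 1, t, - t, - 1]) \<sigma>"
proof -
  have "full t (lvec [- t, 0, 0, 0, 0, - t, t, 0, t, t * t, - t * t, - t]) \<sigma>"
    using full_commutator[OF f tv_g] t by (simp add: \<sigma>_def algebra_simps)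
  from full_smult[OF this, of "1 / t"] show ?thesis using t by (simp add: field_simps)
qed

text \<open>The coefficients are those of $1 - z^2 + z^3 + z^4 - z^5$, the inverse of
  $z^4 + z^3 - 1$ modulo $1 + z + \dots + z^6$.\<close>

lemma full_d0:
  assumes f0: "full t (lvec [- 1, 0, 0, 0, 0, 0, - 1, 1, 0, 1, 0, - 1]) \<sigma>"
  shows "full t (lvec [0, 0, 0, 0, 0, 1, - 1, 0, 0, 0, - 1, 1]) \<sigma>"
proof -
  have f1: "full t (lvec [- t, - 1, 0, 0, 0, - 1, 0, - 1, 1, 0, 1, 0]) \<sigma>"
    using full_XY[OF f0] by (simp add: algebra_simps)
  have f2: "full t (lvec [0, - t, - 1, 0, 0, 0, - 1, 0, - 1, 1, 0, 1]) \<sigma>"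
    using full_XY[OF f1] by (simp add: algebra_simps)
  have f3: "full t (lvec [t, 0, - t, - 1, 0, 1, 0, - 1, 0, - 1, 1, 0]) \<sigma>"
    using full_XY[OF f2] by (simp add: algebra_simps)
  have f4: "full t (lvec [0, t, 0, - t, - 1, 0, 1, 0, - 1, 0, - 1, 1]) \<sigma>"
    using full_XY[OF f3] by (simp add: algebra_simps)
  have f5: "full t (lvec [- 1 + t, 0, t, 0, - t, 1, 0, 1, 0, - 1, 0, - 1]) \<sigma>"
    using full_XY[OF f4] by (simp add: algebra_simps)
  have f6: "full t (lvec [- 2 * t, - 1 + t, 0, t, 0, - 1, 1, 0, 1, 0, - 1, 0]) \<sigma>"
    using full_XY[OF f5] by (simp add: algebra_simps)
  have f7: "full t (lvec [0, - 2 * t, - 1 + t, 0, t, 0, - 1, 1, 0, 1, 0, - 1]) \<sigma>"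
    using full_XY[OF f6] by (simp add: algebra_simps)
  have f8: "full t (lvec [0, 0, - 2 * t, - 1 + t, 0, - 1, 0, - 1, 1, 0, 1, 0]) \<sigma>"
    using full_XY[OF f7] by (simp add: algebra_simps)
  have f9: "full t (lvec [0, 0, 0, - 2 * t, - 1 + t, 0, - 1, 0, - 1, 1, 0, 1]) \<sigma>"
    using full_XY[OF f8] by (simp add: algebra_simps)
  have f10: "full t (lvec [- 1 + 2 * t, 0, 0, 0, - 2 * t, 1, 0, - 1, 0, - 1, 1, 0]) \<sigma>"
    using full_XY[OF f9] by (simp add: algebra_simps)
  \<comment> \<open>On the 7-cycle the vector of \<open>f0\<close> is -z(z - 1)(z^4 + z^3 - 1)
    applied to the sixth basis vector. The stated inverse is used times 1 - z^5, which kills the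
    span of the first five basis vectors. What results is z times the wanted vector, so one step
    back follows.\<close>
  have "lvec [t, 0, 0, 0, 0, 1, 1, - 1, 0, 0, 0, - 1] =
      (- 2) \<cdot>\<^sub>v lvec [- 1 + t, 0, t, 0, - t, 1, 0, 1, 0, - 1, 0, - 1]
      + (1 \<cdot>\<^sub>v lvec [- 1, 0, 0, 0, 0, 0, - 1, 1, 0, 1, 0, - 1]
      + (1 \<cdot>\<^sub>v lvec [0, - 2 * t, - 1 + t, 0, t, 0, - 1, 1, 0, 1, 0, - 1]
      + ((- 1) \<cdot>\<^sub>v lvec [0, - t, - 1, 0, 0, 0, - 1, 0, - 1, 1, 0, 1]
      + ((- 1) \<cdot>\<^sub>v lvec [0, 0, - 2 * t, - 1 + t, 0, - 1, 0, - 1, 1, 0, 1, 0]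
      + (1 \<cdot>\<^sub>v lvec [t, 0, - t, - 1, 0, 1, 0, - 1, 0, - 1, 1, 0]
      + ((- 1) \<cdot>\<^sub>v lvec [0, 0, 0, - 2 * t, - 1 + t, 0, - 1, 0, - 1, 1, 0, 1]
      + (1 \<cdot>\<^sub>v lvec [0, t, 0, - t, - 1, 0, 1, 0, - 1, 0, - 1, 1]
      + (1 \<cdot>\<^sub>v lvec [- 1 + 2 * t, 0, 0, 0, - 2 * t, 1, 0, - 1, 0, - 1, 1, 0]))))))))"
    by (simp add: algebra_simps)
  also have "full t \<dots> \<sigma>"
    by (intro full_add full_smult f0 f2 f3 f4 f5 f7 f8 f9 f10)
  finally show ?thesis using full_XY_inverse by fastforce
qed

text \<open>The sum of the translates \<open>g1\<close> and \<open>d1\<close> is conjugated by the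
  first seven letters applied in \<open>tv_g\<close>. The resulting functional takes the value 1 on
  the vector of \<open>d0\<close>, so a commutator brings back \<open>\<sigma>\<close>.\<close>

lemma full_h:
  assumes g0: "full t (lvec [- 1, 0, 0, 0, 0, - 1, 1, 0, 1, t, - t, - 1]) \<sigma>" and d0: "full t (lvec [0, 0, 0, 0, 0, 1, - 1, 0, 0, 0, - 1, 1]) \<sigma>"
  shows "full t (lvec [0, 0, 0, - t, - 1, 0, 1 + t, 0, - t, - 1, 0, 0]) \<sigma>"
proof -
  have g1: "full t (lvec [- t, - 1, 0, 0, 0, - 1, - 1, 1, 0, 1, t, - t]) \<sigma>"
    using full_XY[OF g0] by (simp add: algebra_simps)
  have d1: "full t (lvec [t, 0, 0, 0, 0, 1, 1, - 1, 0, 0, 0, - 1]) \<sigma>"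
    using full_XY[OF d0] by (simp add: algebra_simps)
  have s: "full t (lvec [0, - 1, 0, 0, 0, 0, 0, 0, 0, 1, t, - 1 - t])
     (lvec [0, 0, 0, 0, 0, 1, 1, 1, 1, 1, 1, 1])"
    using full_add[OF g1 d1] by (simp add: \<sigma>_def algebra_simps)
  have s0: "full t (lvec [0, 0, - t, 0, 0, - 1 - t, 0, 0, 0, 0, - 1, 1])
      (lvec [0, - 1, - 1, 1, 1, 1, 0, 0, 1, 0, - 1, 0])"
    using full_Y[OF s] by (simp add: algebra_simps)
  have s1: "full t (lvec [0, 1 + t, 1, 0, 0, 1, 0, 0, 0, - t, 0, 0])
      (lvec [- 1, - 1, 1, 1, 0, 0, 0, 1, 0, - 1, 0, 1])"
    using full_Y[OF s0] by (simp add: algebra_simps)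
  have s2: "full t (lvec [t, 0, 0, - t, 0, 1, - 1 - t, 0, 0, 0, 0, - 1])
      (lvec [1, 0, - 1, - 1, 1, - t, 1, 0, 0, 1, 0, - 1])"
    using full_X[OF s1] by (simp add: algebra_simps)
  have s3: "full t (lvec [0, - 1, 0, 0, - 1 - t, - 1, - t, - t, 0, 0, 0, 0])
      (lvec [- 1, t, 0, 0, 1, - 1, - 1, - 1, 0, - 1, - 1, 0])"
    using full_Y[OF s2] by (simp add: algebra_simps)
  have s4: "full t (lvec [1 + t, 1, 0, 0, - t, 0, 0, 0, - t, 0, 0, 1])
      (lvec [- 1, 1, 1, 0, - 1, 0, 1, 0, - 1, 0, 1, - t])"
    using full_Y[OF s3] by (simp add: algebra_simps)
  have s5: "full t (lvec [- 1 - t, 0, - 1, 0, 0, 0, - 1, - t, - t, 0, 0, 0])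
      (lvec [1, - 1, t, 0, 0, - t, - 1, - 1, - 1, 0, - 1, - 1])"
    using full_X[OF s4] by (simp add: algebra_simps)
  have s6: "full t (lvec [0, 0, 0, - t, - 1, 0, 1 + t, 0, - t, - 1, 0, 0])
      (lvec [0, t, 1, - 1, - 1, - 1, - 1, 0, - 1, t, 0, 1])"
    using full_Y[OF s5] by (simp add: algebra_simps)
  show ?thesis
    by (rule full_commutator[OF d0 full_imp_tv[OF s6]]) (simp_all add: \<sigma>_def algebra_simps)
qed

text \<open>
  The spanning vectors below generate the kernel of \<^term>\<open>\<sigma>\<close> already over
  \<open>\<int>[t, 1/t]\<close>, which is why no prime has to be excluded. Let $z$ denote the action of
  \<^term>\<open>X t * Y\<close>. Modulo the translates of the vector of \<open>d0\<close>, which is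
  $(z^5 - 1)(z - 1)b_0$ with $b_0$ the sixth basis vector, the vector of \<open>r0\<close> makes $t$
  act as $z - z^2 - z^4$, and then $t$ times the vector of \<open>h0\<close> is
  $1 + 3z + z^2 - 2z^3 - 2z^4$ times $e_0 = (z - 1)b_0$. This factor is invertible modulo
  $z^5 - 1$ with inverse $-2 + z + z^2 - 2z^3 + 3z^4$.
\<close>

lemma full_e0:
  assumes f0: "full t (lvec [- 1, 0, 0, 0, 0, 0, - 1, 1, 0, 1, 0, - 1]) \<sigma>" and g0: "full t (lvec [- 1, 0, 0, 0, 0, - 1, 1, 0, 1, t, - t, - 1]) \<sigma>"
    and d0: "full t (lvec [0, 0, 0, 0, 0, 1, - 1, 0, 0, 0, - 1, 1]) \<sigma>" and h0: "full t (lvec [0, 0, 0, - t, - 1, 0, 1 + t, 0, - t, - 1, 0, 0]) \<sigma>"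
  shows "full t (lvec [0, 0, 0, 0, 0, - 1, 1, 0, 0, 0, 0, 0]) \<sigma>"
proof -
  have r0: "full t (lvec [0, 0, 0, 0, 0, 1, - 2, 1, - 1, 1 - t, t, 0]) \<sigma>"
    using full_add[OF f0 full_smult[OF g0, of "- 1"]] by (simp add: algebra_simps)
  have r1: "full t (lvec [0, 0, 0, 0, 0, 0, 1, - 2, 1, - 1, 1 - t, t]) \<sigma>"
    using full_XY[OF r0] by (simp add: algebra_simps)
  have r2: "full t (lvec [t * t, 0, 0, 0, 0, t, 0, 1, - 2, 1, - 1, 1 - t]) \<sigma>"
    using full_XY[OF r1] by (simp add: algebra_simps)
  have r3: "full t (lvec [t - t * t, t * t, 0, 0, 0, 1 - t, t, 0, 1, - 2, 1, - 1]) \<sigma>"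
    using full_XY[OF r2] by (simp add: algebra_simps)
  have r4: "full t (lvec [- t, t - t * t, t * t, 0, 0, - 1, 1 - t, t, 0, 1, - 2, 1]) \<sigma>"
    using full_XY[OF r3] by (simp add: algebra_simps)
  have h1: "full t (lvec [- 1, 0, 0, 0, - t, 0, 0, 1 + t, 0, - t, - 1, 0]) \<sigma>"
    using full_XY[OF h0] by (simp add: algebra_simps)
  have h2: "full t (lvec [- t, - 1, 0, 0, 0, 0, 0, 0, 1 + t, 0, - t, - 1]) \<sigma>"
    using full_XY[OF h1] by (simp add: algebra_simps)
  have h3: "full t (lvec [- t, - t, - 1, 0, 0, - 1, 0, 0, 0, 1 + t, 0, - t]) \<sigma>"
    using full_XY[OF h2] by (simp add: algebra_simps)
  have h4: "full t (lvec [- t * t, - t, - t, - 1, 0, - t, - 1, 0, 0, 0, 1 + t, 0]) \<sigma>"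
    using full_XY[OF h3] by (simp add: algebra_simps)
  have d1: "full t (lvec [t, 0, 0, 0, 0, 1, 1, - 1, 0, 0, 0, - 1]) \<sigma>"
    using full_XY[OF d0] by (simp add: algebra_simps)
  have d2: "full t (lvec [- t, t, 0, 0, 0, - 1, 1, 1, - 1, 0, 0, 0]) \<sigma>"
    using full_XY[OF d1] by (simp add: algebra_simps)
  have d3: "full t (lvec [0, - t, t, 0, 0, 0, - 1, 1, 1, - 1, 0, 0]) \<sigma>"
    using full_XY[OF d2] by (simp add: algebra_simps)
  have d4: "full t (lvec [0, 0, - t, t, 0, 0, 0, - 1, 1, 1, - 1, 0]) \<sigma>"
    using full_XY[OF d3] by (simp add: algebra_simps)
  have d5: "full t (lvec [0, 0, 0, - t, t, 0, 0, 0, - 1, 1, 1, - 1]) \<sigma>"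
    using full_XY[OF d4] by (simp add: algebra_simps)
  have "lvec [0, 0, 0, 0, 0, - 1, 1, 0, 0, 0, 0, 0] =
      (- 2 * t) \<cdot>\<^sub>v lvec [0, 0, 0, - t, - 1, 0, 1 + t, 0, - t, - 1, 0, 0]
      + ((2 - t) \<cdot>\<^sub>v lvec [0, 0, 0, 0, 0, 1, - 2, 1, - 1, 1 - t, t, 0]
      + ((t) \<cdot>\<^sub>v lvec [- 1, 0, 0, 0, - t, 0, 0, 1 + t, 0, - t, - 1, 0]
      + ((1 + t) \<cdot>\<^sub>v lvec [0, 0, 0, 0, 0, 0, 1, - 2, 1, - 1, 1 - t, t]
      + ((t) \<cdot>\<^sub>v lvec [- t, - 1, 0, 0, 0, 0, 0, 0, 1 + t, 0, - t, - 1]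
      + ((2 + t) \<cdot>\<^sub>v lvec [t * t, 0, 0, 0, 0, t, 0, 1, - 2, 1, - 1, 1 - t]
      + ((- 2 * t) \<cdot>\<^sub>v lvec [- t, - t, - 1, 0, 0, - 1, 0, 0, 0, 1 + t, 0, - t]
      + ((2 - t) \<cdot>\<^sub>v lvec [t - t * t, t * t, 0, 0, 0, 1 - t, t, 0, 1, - 2, 1, - 1]
      + ((3 * t) \<cdot>\<^sub>v lvec [- t * t, - t, - t, - 1, 0, - t, - 1, 0, 0, 0, 1 + t, 0]
      + ((1 + 2 * t) \<cdot>\<^sub>v lvec [- t, t - t * t, t * t, 0, 0, - 1, 1 - t, t, 0, 1, - 2, 1]
      + ((- 4) \<cdot>\<^sub>v lvec [0, 0, 0, 0, 0, 1, - 1, 0, 0, 0, - 1, 1]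
      + ((- 1 + t + 2 * (t * t)) \<cdot>\<^sub>v lvec [t, 0, 0, 0, 0, 1, 1, - 1, 0, 0, 0, - 1]
      + ((- 1 - t + t * t) \<cdot>\<^sub>v lvec [- t, t, 0, 0, 0, - 1, 1, 1, - 1, 0, 0, 0]
      + ((- 1 + t - 2 * (t * t)) \<cdot>\<^sub>v lvec [0, - t, t, 0, 0, 0, - 1, 1, 1, - 1, 0, 0]
      + ((1 - t) \<cdot>\<^sub>v lvec [0, 0, - t, t, 0, 0, 0, - 1, 1, 1, - 1, 0]
      + ((- 2 + t) \<cdot>\<^sub>v lvec [0, 0, 0, - t, t, 0, 0, 0, - 1, 1, 1, - 1])))))))))))))))"
    by (simp add: algebra_simps)
  also have "full t \<dots> \<sigma>"
    by (intro full_add full_smult h0 r0 h1 r1 h2 r2 h3 r3 h4 r4 d0 d1 d2 d3 d4 d5)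
  finally show ?thesis .
qed

lemma full_kernel:
  assumes t: "t \<noteq> 0" and e0: "full t (lvec [0, 0, 0, 0, 0, - 1, 1, 0, 0, 0, 0, 0]) \<sigma>"
    and u: "u \<in> carrier_vec 12" "\<sigma> \<bullet> u = 0"
  shows "full t u \<sigma>"
proof -
  have e1: "full t (lvec [0, 0, 0, 0, 0, 0, - 1, 1, 0, 0, 0, 0]) \<sigma>"
    using full_XY[OF e0] by (simp add: algebra_simps)
  have e2: "full t (lvec [0, 0, 0, 0, 0, 0, 0, - 1, 1, 0, 0, 0]) \<sigma>"
    using full_XY[OF e1] by (simp add: algebra_simps)
  have e3: "full t (lvec [0, 0, 0, 0, 0, 0, 0, 0, - 1, 1, 0, 0]) \<sigma>"
    using full_XY[OF e2] by (simp add: algebra_simps)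
  have e4: "full t (lvec [0, 0, 0, 0, 0, 0, 0, 0, 0, - 1, 1, 0]) \<sigma>"
    using full_XY[OF e3] by (simp add: algebra_simps)
  have e5: "full t (lvec [0, 0, 0, 0, 0, 0, 0, 0, 0, 0, - 1, 1]) \<sigma>"
    using full_XY[OF e4] by (simp add: algebra_simps)
  have e6: "full t (lvec [t, 0, 0, 0, 0, 1, 0, 0, 0, 0, 0, - 1]) \<sigma>"
    using full_XY[OF e5] by (simp add: algebra_simps)
  \<comment> \<open>The neighbour differences around the 7-cycle telescope to 0 there; only the
    coupling entry \<open>t\<close>, picked up at the wrap-around in \<open>e6\<close>,
    survives.\<close>
  have "lvec [t, 0, 0, 0, 0, 0, 0, 0, 0, 0, 0, 0] =
      1 \<cdot>\<^sub>v lvec [0, 0, 0, 0, 0, - 1, 1, 0, 0, 0, 0, 0]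
      + (1 \<cdot>\<^sub>v lvec [0, 0, 0, 0, 0, 0, - 1, 1, 0, 0, 0, 0]
      + (1 \<cdot>\<^sub>v lvec [0, 0, 0, 0, 0, 0, 0, - 1, 1, 0, 0, 0]
      + (1 \<cdot>\<^sub>v lvec [0, 0, 0, 0, 0, 0, 0, 0, - 1, 1, 0, 0]
      + (1 \<cdot>\<^sub>v lvec [0, 0, 0, 0, 0, 0, 0, 0, 0, - 1, 1, 0]
      + (1 \<cdot>\<^sub>v lvec [0, 0, 0, 0, 0, 0, 0, 0, 0, 0, - 1, 1]
      + (1 \<cdot>\<^sub>v lvec [t, 0, 0, 0, 0, 1, 0, 0, 0, 0, 0, - 1]))))))"
    by (simp add: algebra_simps)
  also have "full t \<dots> \<sigma>"
    by (intro full_add full_smult e0 e1 e2 e3 e4 e5 e6)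
  finally have "full t (lvec [t, 0, 0, 0, 0, 0, 0, 0, 0, 0, 0, 0]) \<sigma>" .
  from full_smult[OF this, of "1 / t"] t have a0: "full t (lvec [1, 0, 0, 0, 0, 0, 0, 0, 0, 0, 0, 0]) \<sigma>" by simp
  have a1: "full t (lvec [0, 1, 0, 0, 0, 0, 0, 0, 0, 0, 0, 0]) \<sigma>"
    using full_XY[OF a0] by (simp add: algebra_simps)
  have a2: "full t (lvec [0, 0, 1, 0, 0, 0, 0, 0, 0, 0, 0, 0]) \<sigma>"
    using full_XY[OF a1] by (simp add: algebra_simps)
  have a3: "full t (lvec [0, 0, 0, 1, 0, 0, 0, 0, 0, 0, 0, 0]) \<sigma>"
    using full_XY[OF a2] by (simp add: algebra_simps)
  have a4: "full t (lvec [0, 0, 0, 0, 1, 0, 0, 0, 0, 0, 0, 0]) \<sigma>"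
    using full_XY[OF a3] by (simp add: algebra_simps)
  show ?thesis
    using u(1)
  proof (cases u rule: lvec12_cases)
    case (1 u0 u1 u2 u3 u4 u5 u6 u7 u8 u9 u10 u11)
    have u11: "u11 = - (u5 + u6 + u7 + u8 + u9 + u10)"
      using u(2) by (simp add: 1 \<sigma>_def add_eq_0_iff2 add.assoc)
    \<comment> \<open>Summation by parts: the coefficients of the neighbour differences are negated
      partial sums of the last seven coordinates.\<close>
    have "u =
      u0 \<cdot>\<^sub>v lvec [1, 0, 0, 0, 0, 0, 0, 0, 0, 0, 0, 0]
      + (u1 \<cdot>\<^sub>v lvec [0, 1, 0, 0, 0, 0, 0, 0, 0, 0, 0, 0]
      + (u2 \<cdot>\<^sub>v lvec [0, 0, 1, 0, 0, 0, 0, 0, 0, 0, 0, 0]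
      + (u3 \<cdot>\<^sub>v lvec [0, 0, 0, 1, 0, 0, 0, 0, 0, 0, 0, 0]
      + (u4 \<cdot>\<^sub>v lvec [0, 0, 0, 0, 1, 0, 0, 0, 0, 0, 0, 0]
      + ((- (u5)) \<cdot>\<^sub>v lvec [0, 0, 0, 0, 0, - 1, 1, 0, 0, 0, 0, 0]
      + ((- (u5 + u6)) \<cdot>\<^sub>v lvec [0, 0, 0, 0, 0, 0, - 1, 1, 0, 0, 0, 0]
      + ((- (u5 + u6 + u7)) \<cdot>\<^sub>v lvec [0, 0, 0, 0, 0, 0, 0, - 1, 1, 0, 0, 0]
      + ((- (u5 + u6 + u7 + u8)) \<cdot>\<^sub>v lvec [0, 0, 0, 0, 0, 0, 0, 0, - 1, 1, 0, 0]
      + ((- (u5 + u6 + u7 + u8 + u9)) \<cdot>\<^sub>v lvec [0, 0, 0, 0, 0, 0, 0, 0, 0, - 1, 1, 0]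
      + ((- (u5 + u6 + u7 + u8 + u9 + u10)) \<cdot>\<^sub>v lvec [0, 0, 0, 0, 0, 0, 0, 0, 0, 0, - 1, 1]))))))))))"
      unfolding 1 u11 by (simp add: algebra_simps)
    also have "full t \<dots> \<sigma>"
      by (intro full_add full_smult a0 a1 a2 a3 a4 e0 e1 e2 e3 e4 e5)
    finally show ?thesis .
  qed
qed

subsection \<open>The space of functionals\<close>

text \<open>The zero functional qualifies, since T(u, 0) is the identity; this lets the predicate
  describe a subspace.\<close>

definition Phi :: "'a::{field,finite} \<Rightarrow> 'a vec \<Rightarrow> bool" where
  "Phi t \<phi> \<longleftrightarrow> \<phi> \<in> carrier_vec 12 \<and> (\<forall>u\<in>carrier_vec 12. \<phi> \<bullet> u = 0 \<longrightarrow> tv t u \<phi>)"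

lemma Phi_smult:
  assumes "Phi t \<phi>"
  shows "Phi t (c \<cdot>\<^sub>v \<phi>)"
proof -
  have p: "\<phi> \<in> carrier_vec 12" using assms by (simp add: Phi_def)
  have "tv t u (c \<cdot>\<^sub>v \<phi>)" if u: "u \<in> carrier_vec 12" "(c \<cdot>\<^sub>v \<phi>) \<bullet> u = 0" for u
  proof -
    have "\<phi> \<bullet> (c \<cdot>\<^sub>v u) = 0" using u p by simp
    then have "tv t (c \<cdot>\<^sub>v u) \<phi>" using assms u by (simp add: Phi_def)
    then show ?thesis using u p by (simp add: tv_def transv_smult_functional[of _ 12])
  qed
  then show ?thesis using p by (simp add: Phi_def)
qed

text \<open>T(w, phi o B) is the conjugate by \<open>A\<close> of T(Bw, phi), because
  \<open>A\<close> and \<open>B\<close> are mutually inverse.\<close>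

lemma Phi_conjugate:
  assumes phi: "Phi t \<phi>" and A: "A \<in> H t" and B: "B \<in> H t" and AB: "A * B = 1\<^sub>m 12"
  shows "Phi t (B\<^sup>T *\<^sub>v \<phi>)"
proof -
  have p: "\<phi> \<in> carrier_vec 12" using phi by (simp add: Phi_def)
  have c: "A \<in> carrier_mat 12 12" "B \<in> carrier_mat 12 12" using A B H_carrier by auto
  have "tv t w (B\<^sup>T *\<^sub>v \<phi>)" if w: "w \<in> carrier_vec 12" "(B\<^sup>T *\<^sub>v \<phi>) \<bullet> w = 0" for w
  proof -
    have "\<phi> \<bullet> (B *\<^sub>v w) = 0" using transpose_vec_mult_scalar[OF c(2) w(1) p] w(2) by simp
    then have "tv t (B *\<^sub>v w) \<phi>" using phi c w by (auto simp: Phi_def)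
    from tv_conjugate[OF this A B AB] show ?thesis
      using c w AB by (simp flip: assoc_mult_mat_vec)
  qed
  then show ?thesis using c p by (auto simp: Phi_def)
qed

text \<open>For independent functionals choose u with psi(u) = 0 and phi(u) = 1. Then T(u, psi) lies
  in \<open>H t\<close>, and precomposing phi with it gives phi + psi. Dependent functionals reduce
  to scaling.\<close>

lemma Phi_add:
  assumes phi: "Phi t \<phi>" and psi: "Phi t \<psi>"
  shows "Phi t (\<phi> + \<psi>)"
proof -
  have p: "\<phi> \<in> carrier_vec 12" "\<psi> \<in> carrier_vec 12" using assms by (auto simp: Phi_def)
  consider "\<psi> = 0\<^sub>v 12" | c where "\<phi> = c \<cdot>\<^sub>v \<psi>" | "\<psi> \<noteq> 0\<^sub>v 12" "\<And>c. \<phi> \<noteq> c \<cdot>\<^sub>v \<psi>"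
    by blast
  then show ?thesis
  proof cases
    case 1
    then show ?thesis using phi p by simp
  next
    case 2
    then have "\<phi> + \<psi> = (c + 1) \<cdot>\<^sub>v \<psi>"
      using p by (auto intro!: eq_vecI simp: algebra_simps)
    then show ?thesis using Phi_smult[OF psi] by simp
  next
    case 3
    then obtain u where u: "u \<in> carrier_vec 12" "\<psi> \<bullet> u = 0" "\<phi> \<bullet> u = 1"
      using independent_functionals[OF p] by blast
    have tu: "tv t u \<psi>" using psi u by (simp add: Phi_def)
    have H: "transv (- u) \<psi> \<in> H t" "transv u \<psi> \<in> H t"
      using tu tv_uminus[OF tu] by (auto simp: tv_def)
    have "transv (- u) \<psi> * transv u \<psi> = transv (- u + u) \<psi>"
      using u p by (intro transv_mult_transv[of _ 12]) auto
    also have "- u + u = 0\<^sub>v 12" using u by simp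
    finally have "transv (- u) \<psi> * transv u \<psi> = 1\<^sub>m 12" by simp
    from Phi_conjugate[OF phi H this] show ?thesis
      using u p comm_scalar_prod[of \<phi> 12 u]
      by (simp add: transpose_transv[of _ 12] transv_mult_vec[of _ 12])
  qed
qed

section \<open>The generators acting on functionals\<close>

lemma Phi_X:
  "Phi t (lvec [w0, w1, w2, w3, w4, w5, w6, w7, w8, w9, w10, w11]) \<Longrightarrow>
   Phi t (lvec [- w0, - w6, - w11, w9, w7, w5 + t * w0, - w1, w4, w8, w3, - w10, - w2])"
  using Phi_conjugate[OF _ X_in_H X_in_H X_mult_X] by (fastforce simp: X_transpose_mult)

lemma Phi_Y:
  "Phi t (lvec [w0, w1, w2, w3, w4, w5, w6, w7, w8, w9, w10, w11]) \<Longrightarrow>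
   Phi t (lvec [- w4, - w5, - w10, w8, w6, w11, - w0, w3, w7, w2, - w9, - w1])"
  using Phi_conjugate[OF _ Y_in_H H_mult[OF Y_in_H Y_in_H] Y_mult_YY]
  by (fastforce simp: Y_inverse_transpose)

lemma Phi_XY:
  "Phi t (lvec [w0, w1, w2, w3, w4, w5, w6, w7, w8, w9, w10, w11]) \<Longrightarrow>
   Phi t (lvec [w1, w2, w3, w4, w0, w6, w7, w8, w9, w10, w11, w5 + t * w0])"
  by (drule Phi_X, drule Phi_Y, drule Phi_Y) (simp add: algebra_simps)

text \<open>(XY)^5 fixes each of the first five basis vectors, so subtracting a functional from its
  fifth translate clears those five coordinates. Here this is done for the image of
  \<open>\<sigma>\<close> under \<open>X t\<close>.\<close>

lemma Phi_m0:
  assumes s: "Phi t (lvec [0, 0, 0, 0, 0, 1, 1, 1, 1, 1, 1, 1])"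
  shows "Phi t (lvec [0, 0, 0, 0, 0, - 2, 0, 1, - 1 - t, - t, 2 + t, t])"
proof -
  have s0: "Phi t (lvec [0, - 1, - 1, 1, 1, 1, 0, 0, 1, 0, - 1, 0])"
    using Phi_X[OF s] by (simp add: algebra_simps)
  have w1: "Phi t (lvec [- 1, - 1, 1, 1, 0, 0, 0, 1, 0, - 1, 0, 1])"
    using Phi_XY[OF s0] by (simp add: algebra_simps)
  have w2: "Phi t (lvec [- 1, 1, 1, 0, - 1, 0, 1, 0, - 1, 0, 1, - t])"
    using Phi_XY[OF w1] by (simp add: algebra_simps)
  have w3: "Phi t (lvec [1, 1, 0, - 1, - 1, 1, 0, - 1, 0, 1, - t, - t])"
    using Phi_XY[OF w2] by (simp add: algebra_simps)
  have w4: "Phi t (lvec [1, 0, - 1, - 1, 1, 0, - 1, 0, 1, - t, - t, 1 + t])"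
    using Phi_XY[OF w3] by (simp add: algebra_simps)
  have w5: "Phi t (lvec [0, - 1, - 1, 1, 1, - 1, 0, 1, - t, - t, 1 + t, t])"
    using Phi_XY[OF w4] by (simp add: algebra_simps)
  show ?thesis using Phi_add[OF w5 Phi_smult[OF s0, of "- 1"]] by (simp add: algebra_simps)
qed

text \<open>The same difference of translates, taken for \<open>\<sigma>\<close> moved by the seven
  letters used in \<open>full_h\<close>.\<close>

lemma Phi_n0:
  assumes s: "Phi t (lvec [0, 0, 0, 0, 0, 1, 1, 1, 1, 1, 1, 1])"
  shows "Phi t (lvec [0, 0, 0, 0, 0, 1, 2, - 1, t * t, 0, - 1 - t, - 1])"
proof -
  have s0: "Phi t (lvec [0, - 1, - 1, 1, 1, 1, 0, 0, 1, 0, - 1, 0])"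
    using Phi_Y[OF s] by (simp add: algebra_simps)
  have s1: "Phi t (lvec [- 1, - 1, 1, 1, 0, 0, 0, 1, 0, - 1, 0, 1])"
    using Phi_Y[OF s0] by (simp add: algebra_simps)
  have s2: "Phi t (lvec [1, 0, - 1, - 1, 1, - t, 1, 0, 0, 1, 0, - 1])"
    using Phi_X[OF s1] by (simp add: algebra_simps)
  have s3: "Phi t (lvec [- 1, t, 0, 0, 1, - 1, - 1, - 1, 0, - 1, - 1, 0])"
    using Phi_Y[OF s2] by (simp add: algebra_simps)
  have s4: "Phi t (lvec [- 1, 1, 1, 0, - 1, 0, 1, 0, - 1, 0, 1, - t])"
    using Phi_Y[OF s3] by (simp add: algebra_simps)
  have s5: "Phi t (lvec [1, - 1, t, 0, 0, - t, - 1, - 1, - 1, 0, - 1, - 1])"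
    using Phi_X[OF s4] by (simp add: algebra_simps)
  have s6: "Phi t (lvec [0, t, 1, - 1, - 1, - 1, - 1, 0, - 1, t, 0, 1])"
    using Phi_Y[OF s5] by (simp add: algebra_simps)
  have w1: "Phi t (lvec [t, 1, - 1, - 1, 0, - 1, 0, - 1, t, 0, 1, - 1])"
    using Phi_XY[OF s6] by (simp add: algebra_simps)
  have w2: "Phi t (lvec [1, - 1, - 1, 0, t, 0, - 1, t, 0, 1, - 1, - 1 + t * t])"
    using Phi_XY[OF w1] by (simp add: algebra_simps)
  have w3: "Phi t (lvec [- 1, - 1, 0, t, 1, - 1, t, 0, 1, - 1, - 1 + t * t, t])"
    using Phi_XY[OF w2] by (simp add: algebra_simps)
  have w4: "Phi t (lvec [- 1, 0, t, 1, - 1, t, 0, 1, - 1, - 1 + t * t, t, - 1 - t])"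
    using Phi_XY[OF w3] by (simp add: algebra_simps)
  have w5: "Phi t (lvec [0, t, 1, - 1, - 1, 0, 1, - 1, - 1 + t * t, t, - 1 - t, 0])"
    using Phi_XY[OF w4] by (simp add: algebra_simps)
  show ?thesis using Phi_add[OF w5 Phi_smult[OF s6, of "- 1"]] by (simp add: algebra_simps)
qed

text \<open>The same difference after only the first four of these letters. Its entries sum to t^2,
  which is what \<open>Phi_b3\<close> exploits.\<close>

lemma Phi_k0:
  assumes s: "Phi t (lvec [0, 0, 0, 0, 0, 1, 1, 1, 1, 1, 1, 1])"
  shows "Phi t (lvec [0, 0, 0, 0, 0, 0, 1, - t, - 1 + t * t, 0, 1, - 1 + t])"
proof -
  have s0: "Phi t (lvec [0, - 1, - 1, 1, 1, 1, 0, 0, 1, 0, - 1, 0])"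
    using Phi_Y[OF s] by (simp add: algebra_simps)
  have s1: "Phi t (lvec [- 1, - 1, 1, 1, 0, 0, 0, 1, 0, - 1, 0, 1])"
    using Phi_Y[OF s0] by (simp add: algebra_simps)
  have s2: "Phi t (lvec [1, 0, - 1, - 1, 1, - t, 1, 0, 0, 1, 0, - 1])"
    using Phi_X[OF s1] by (simp add: algebra_simps)
  have s3: "Phi t (lvec [- 1, t, 0, 0, 1, - 1, - 1, - 1, 0, - 1, - 1, 0])"
    using Phi_Y[OF s2] by (simp add: algebra_simps)
  have w1: "Phi t (lvec [t, 0, 0, 1, - 1, - 1, - 1, 0, - 1, - 1, 0, - 1 - t])"
    using Phi_XY[OF s3] by (simp add: algebra_simps)
  have w2: "Phi t (lvec [0, 0, 1, - 1, t, - 1, 0, - 1, - 1, 0, - 1 - t, - 1 + t * t])"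
    using Phi_XY[OF w1] by (simp add: algebra_simps)
  have w3: "Phi t (lvec [0, 1, - 1, t, 0, 0, - 1, - 1, 0, - 1 - t, - 1 + t * t, - 1])"
    using Phi_XY[OF w2] by (simp add: algebra_simps)
  have w4: "Phi t (lvec [1, - 1, t, 0, 0, - 1, - 1, 0, - 1 - t, - 1 + t * t, - 1, 0])"
    using Phi_XY[OF w3] by (simp add: algebra_simps)
  have w5: "Phi t (lvec [- 1, t, 0, 0, 1, - 1, 0, - 1 - t, - 1 + t * t, - 1, 0, - 1 + t])"
    using Phi_XY[OF w4] by (simp add: algebra_simps)
  show ?thesis using Phi_add[OF w5 Phi_smult[OF s3, of "- 1"]] by (simp add: algebra_simps)
qed

text \<open>
  For a functional \<open>\<phi>\<close> of the space, \<open>\<phi> \<circ> ((XY)\<^sup>5 - 1)\<close> lives on the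
  7-cycle, so the functionals obtained this way form a module over \<open>\<int>[t]\<close> with an
  operator $z$ satisfying $z^7 = 1$. The coefficients below come from
  inverting two units modulo $1 + z + \dots + z^6$.
\<close>

lemma Phi_delta:
  assumes m0: "Phi t (lvec [0, 0, 0, 0, 0, - 2, 0, 1, - 1 - t, - t, 2 + t, t])"
    and n0: "Phi t (lvec [0, 0, 0, 0, 0, 1, 2, - 1, t * t, 0, - 1 - t, - 1])"
  shows "Phi t (lvec [0, 0, 0, 0, 0, - 1, 0, 0, 0, 0, 0, 1])"
proof -
  have m1: "Phi t (lvec [0, 0, 0, 0, 0, 0, 1, - 1 - t, - t, 2 + t, t, - 2])"
    using Phi_XY[OF m0] by (simp add: algebra_simps)
  have m2: "Phi t (lvec [0, 0, 0, 0, 0, 1, - 1 - t, - t, 2 + t, t, - 2, 0])"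
    using Phi_XY[OF m1] by (simp add: algebra_simps)
  have m3: "Phi t (lvec [0, 0, 0, 0, 0, - 1 - t, - t, 2 + t, t, - 2, 0, 1])"
    using Phi_XY[OF m2] by (simp add: algebra_simps)
  have m4: "Phi t (lvec [0, 0, 0, 0, 0, - t, 2 + t, t, - 2, 0, 1, - 1 - t])"
    using Phi_XY[OF m3] by (simp add: algebra_simps)
  have m5: "Phi t (lvec [0, 0, 0, 0, 0, 2 + t, t, - 2, 0, 1, - 1 - t, - t])"
    using Phi_XY[OF m4] by (simp add: algebra_simps)
  have m6: "Phi t (lvec [0, 0, 0, 0, 0, t, - 2, 0, 1, - 1 - t, - t, 2 + t])"
    using Phi_XY[OF m5] by (simp add: algebra_simps)
  have n1: "Phi t (lvec [0, 0, 0, 0, 0, 2, - 1, t * t, 0, - 1 - t, - 1, 1])"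
    using Phi_XY[OF n0] by (simp add: algebra_simps)
  have n2: "Phi t (lvec [0, 0, 0, 0, 0, - 1, t * t, 0, - 1 - t, - 1, 1, 2])"
    using Phi_XY[OF n1] by (simp add: algebra_simps)
  have n3: "Phi t (lvec [0, 0, 0, 0, 0, t * t, 0, - 1 - t, - 1, 1, 2, - 1])"
    using Phi_XY[OF n2] by (simp add: algebra_simps)
  have n4: "Phi t (lvec [0, 0, 0, 0, 0, 0, - 1 - t, - 1, 1, 2, - 1, t * t])"
    using Phi_XY[OF n3] by (simp add: algebra_simps)
  have n5: "Phi t (lvec [0, 0, 0, 0, 0, - 1 - t, - 1, 1, 2, - 1, t * t, 0])"
    using Phi_XY[OF n4] by (simp add: algebra_simps)
  have n6: "Phi t (lvec [0, 0, 0, 0, 0, - 1, 1, 2, - 1, t * t, 0, - 1 - t])"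
    using Phi_XY[OF n5] by (simp add: algebra_simps)
  have "lvec [0, 0, 0, 0, 0, - 1, 0, 0, 0, 0, 0, 1] =
      (1) \<cdot>\<^sub>v lvec [0, 0, 0, 0, 0, 1, 2, - 1, t * t, 0, - 1 - t, - 1]
      + ((4 - t) \<cdot>\<^sub>v lvec [0, 0, 0, 0, 0, - 2, 0, 1, - 1 - t, - t, 2 + t, t]
      + ((1) \<cdot>\<^sub>v lvec [0, 0, 0, 0, 0, 2, - 1, t * t, 0, - 1 - t, - 1, 1]
      + ((t) \<cdot>\<^sub>v lvec [0, 0, 0, 0, 0, 0, 1, - 1 - t, - t, 2 + t, t, - 2]
      + ((- 1) \<cdot>\<^sub>v lvec [0, 0, 0, 0, 0, - 1, t * t, 0, - 1 - t, - 1, 1, 2]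
      + ((1 - t) \<cdot>\<^sub>v lvec [0, 0, 0, 0, 0, 1, - 1 - t, - t, 2 + t, t, - 2, 0]
      + ((- 1) \<cdot>\<^sub>v lvec [0, 0, 0, 0, 0, t * t, 0, - 1 - t, - 1, 1, 2, - 1]
      + ((2) \<cdot>\<^sub>v lvec [0, 0, 0, 0, 0, - 1 - t, - t, 2 + t, t, - 2, 0, 1]
      + ((2) \<cdot>\<^sub>v lvec [0, 0, 0, 0, 0, 0, - 1 - t, - 1, 1, 2, - 1, t * t]
      + ((2 - t) \<cdot>\<^sub>v lvec [0, 0, 0, 0, 0, - t, 2 + t, t, - 2, 0, 1, - 1 - t]
      + ((1 + t) \<cdot>\<^sub>v lvec [0, 0, 0, 0, 0, 2 + t, t, - 2, 0, 1, - 1 - t, - t]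
      + ((- 2) \<cdot>\<^sub>v lvec [0, 0, 0, 0, 0, - 1, 1, 2, - 1, t * t, 0, - 1 - t]
      + ((- t) \<cdot>\<^sub>v lvec [0, 0, 0, 0, 0, t, - 2, 0, 1, - 1 - t, - t, 2 + t]))))))))))))"
    by (simp add: algebra_simps)
  also have "Phi t \<dots>"
    by (intro Phi_add Phi_smult n0 m0 n1 m1 n2 m2 n3 m3 n4 m4 m5 n6 m6)
  finally show ?thesis .
qed

text \<open>Modulo the neighbour differences obtained from \<open>d0\<close>, a functional on the
  7-cycle is determined by the sum of its entries. For \<open>k0\<close> this sum is t^2, a
  unit.\<close>

lemma Phi_b3:
  assumes t: "t \<noteq> 0" and d0: "Phi t (lvec [0, 0, 0, 0, 0, - 1, 0, 0, 0, 0, 0, 1])"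
    and k0: "Phi t (lvec [0, 0, 0, 0, 0, 0, 1, - t, - 1 + t * t, 0, 1, - 1 + t])"
  shows "Phi t (lvec [0, 0, 0, 0, 0, 0, 0, 0, 1, 0, 0, 0])"
proof -
  have d1: "Phi t (lvec [0, 0, 0, 0, 0, 0, 0, 0, 0, 0, 1, - 1])"
    using Phi_XY[OF d0] by (simp add: algebra_simps)
  have d2: "Phi t (lvec [0, 0, 0, 0, 0, 0, 0, 0, 0, 1, - 1, 0])"
    using Phi_XY[OF d1] by (simp add: algebra_simps)
  have d3: "Phi t (lvec [0, 0, 0, 0, 0, 0, 0, 0, 1, - 1, 0, 0])"
    using Phi_XY[OF d2] by (simp add: algebra_simps)
  have d4: "Phi t (lvec [0, 0, 0, 0, 0, 0, 0, 1, - 1, 0, 0, 0])"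
    using Phi_XY[OF d3] by (simp add: algebra_simps)
  have d5: "Phi t (lvec [0, 0, 0, 0, 0, 0, 1, - 1, 0, 0, 0, 0])"
    using Phi_XY[OF d4] by (simp add: algebra_simps)
  have "lvec [0, 0, 0, 0, 0, 0, 0, 0, t * t, 0, 0, 0] =
      1 \<cdot>\<^sub>v lvec [0, 0, 0, 0, 0, 0, 1, - t, - 1 + t * t, 0, 1, - 1 + t]
      + ((- 1 + t) \<cdot>\<^sub>v lvec [0, 0, 0, 0, 0, 0, 0, 0, 0, 0, 1, - 1]
      + ((t) \<cdot>\<^sub>v lvec [0, 0, 0, 0, 0, 0, 0, 0, 0, 1, - 1, 0]
      + ((t) \<cdot>\<^sub>v lvec [0, 0, 0, 0, 0, 0, 0, 0, 1, - 1, 0, 0]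
      + ((- 1 + t) \<cdot>\<^sub>v lvec [0, 0, 0, 0, 0, 0, 0, 1, - 1, 0, 0, 0]
      + ((- 1) \<cdot>\<^sub>v lvec [0, 0, 0, 0, 0, 0, 1, - 1, 0, 0, 0, 0])))))"
    by (simp add: algebra_simps)
  also have "Phi t \<dots>"
    by (intro Phi_add Phi_smult k0 d1 d2 d3 d4 d5)
  finally have "Phi t (lvec [0, 0, 0, 0, 0, 0, 0, 0, t * t, 0, 0, 0])" .
  from Phi_smult[OF this, of "1 / (t * t)"] t show ?thesis by simp
qed

text \<open>Up to sign the generators permute the coordinate functionals transitively.
  \<open>X t\<close> is applied only where entry 0 vanishes, so \<open>t\<close> never
  enters.\<close>

lemma Phi_unit_vec:
  assumes p8: "Phi t (lvec [0, 0, 0, 0, 0, 0, 0, 0, 1, 0, 0, 0])" and l: "l < 12"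
  shows "Phi t (unit_vec 12 l)"
proof -
  have p3: "Phi t (lvec [0, 0, 0, 1, 0, 0, 0, 0, 0, 0, 0, 0])"
    using Phi_Y[OF p8] by simp
  have p9: "Phi t (lvec [0, 0, 0, 0, 0, 0, 0, 0, 0, 1, 0, 0])"
    using Phi_X[OF p3] by simp
  have p7: "Phi t (lvec [0, 0, 0, 0, 0, 0, 0, 1, 0, 0, 0, 0])"
    using Phi_Y[OF p3] by simp
  have p10: "Phi t (lvec [0, 0, 0, 0, 0, 0, 0, 0, 0, 0, 1, 0])"
    using Phi_smult[OF Phi_Y[OF p9], of "- 1"] by simp
  have p4: "Phi t (lvec [0, 0, 0, 0, 1, 0, 0, 0, 0, 0, 0, 0])"
    using Phi_X[OF p7] by simp
  have p2: "Phi t (lvec [0, 0, 1, 0, 0, 0, 0, 0, 0, 0, 0, 0])"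
    using Phi_smult[OF Phi_Y[OF p10], of "- 1"] by simp
  have p0: "Phi t (lvec [1, 0, 0, 0, 0, 0, 0, 0, 0, 0, 0, 0])"
    using Phi_smult[OF Phi_Y[OF p4], of "- 1"] by simp
  have p11: "Phi t (lvec [0, 0, 0, 0, 0, 0, 0, 0, 0, 0, 0, 1])"
    using Phi_smult[OF Phi_X[OF p2], of "- 1"] by simp
  have p6: "Phi t (lvec [0, 0, 0, 0, 0, 0, 1, 0, 0, 0, 0, 0])"
    using Phi_smult[OF Phi_Y[OF p0], of "- 1"] by simp
  have p5: "Phi t (lvec [0, 0, 0, 0, 0, 1, 0, 0, 0, 0, 0, 0])"
    using Phi_Y[OF p11] by simp
  have p1: "Phi t (lvec [0, 1, 0, 0, 0, 0, 0, 0, 0, 0, 0, 0])"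
    using Phi_smult[OF Phi_X[OF p6], of "- 1"] by simp
  have e: "unit_vec 12 l = lvec (map (\<lambda>j. if j = l then 1 else 0) [0..<12])"
    by (rule eq_vecI) (auto simp: lvec_def unit_vec_def)
  have "l \<in> set [0..<12]" using l by simp
  then have "l = 0 \<or> l = 1 \<or> l = 2 \<or> l = 3 \<or> l = 4 \<or> l = 5 \<or> l = 6 \<or> l = 7 \<or> l = 8
    \<or> l = 9 \<or> l = 10 \<or> l = 11"
    unfolding upt_12 by simp
  then show ?thesis
    unfolding e by (elim disjE) (use p0 p1 p2 p3 p4 p5 p6 p7 p8 p9 p10 p11 in \<open>simp_all add: upt_12\<close>)
qed

section \<open>From coordinate functionals to the whole special linear group\<close>

lemma H_eq_SL:
  assumes "\<And>l. l < 12 \<Longrightarrow> Phi t (unit_vec 12 l)"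
  shows "H t = carrier (SL 12 TYPE('a::{field,finite}))"
proof
  show "H t \<subseteq> carrier (SL 12 TYPE('a))" using subgroup.subset[OF subgroup_H] .
  show "carrier (SL 12 TYPE('a)) \<subseteq> H t"
  proof
    fix A :: "'a mat" assume "A \<in> carrier (SL 12 TYPE('a))"
    then have "A \<in> carrier_mat 12 12" "det A = 1" by (auto simp: SL_def)
    then show "A \<in> H t"
    proof (induction rule: SL_row_induct)
      case one
      show ?case by (rule H_one)
    next
      case (addrow B a k l)
      \<comment> \<open>Undoing the row addition is left multiplication by an elementary matrix, a
        transvection whose functional is coordinate \<open>l\<close>.\<close>
      have "tv t ((- a) \<cdot>\<^sub>v unit_vec 12 k) (unit_vec 12 l)"
        using assms[of l] addrow by (simp add: Phi_def)
      then have "addrow_mat 12 (- a) k l \<in> H t"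
        using addrow by (simp add: tv_def addrow_mat_transv)
      moreover have "addrow_mat 12 (- a) k l * addrow a k l B = B"
      proof -
        have c: "addrow a k l B \<in> carrier_mat 12 12" using addrow by simp
        have "addrow_mat 12 (- a) k l * addrow a k l B = addrow (- a) k l (addrow a k l B)"
          using addrow_mat[OF c, of l "- a" k] addrow by simp
        also have "\<dots> = B"
          using addrow by (intro eq_matI) auto
        finally show ?thesis .
      qed
      ultimately show ?case using H_mult[of "addrow_mat 12 (- a) k l" t "addrow a k l B"] addrow by simp
    qed
  qed
qed

text \<open>The multiplicative group of a finite field is cyclic; \<open>class_ring\<close>
  transfers this from locale-based fields to the type class.\<close>

lemma exists_generator:
  "\<exists>t::'a::{field,finite}. t \<noteq> 0 \<and> (\<forall>c. c \<noteq> 0 \<longrightarrow> (\<exists>k::nat. c = t ^ k))"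
proof -
  let ?R = "class_ring :: 'a ring"
  have R: "field ?R" by (rule class_field.field_axioms)
  have pow: "a [^]\<^bsub>?R\<^esub> k = a ^ k" for a :: 'a and k :: nat
    by (induction k) (auto simp: mult.commute)
  obtain a where a: "a \<in> carrier (mult_of ?R)"
    "carrier (mult_of ?R) = {a [^]\<^bsub>?R\<^esub> i | i::nat. i \<in> UNIV}"
    using field.finite_field_mult_group_has_gen[OF R] by auto
  have "a \<noteq> 0" using a(1) by simp
  moreover have "\<exists>k::nat. c = a ^ k" if "c \<noteq> 0" for c
  proof -
    have "c \<in> carrier (mult_of ?R)" using that by simp
    then show ?thesis using a(2) pow by auto
  qed
  ultimately show ?thesis by blast
qed

theorem proposition2p3:
  fixes p a :: nat
  assumes "prime p" and "p \<noteq> 5" and "a \<ge> 1"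
    and "CARD('a::{field,finite}) = p ^ a"
  shows "two_three_generated (SL 12 TYPE('a))"
proof -
  let ?G = "SL 12 TYPE('a)"
  obtain t :: 'a where t: "t \<noteq> 0" and gen: "\<And>c. c \<noteq> 0 \<Longrightarrow> \<exists>k::nat. c = t ^ k"
    using exists_generator by blast
  note f = full_f[OF t gen]
  note g = full_g[OF t f]
  note d0 = full_d0[OF f]
  note e0 = full_e0[OF f g d0 full_h[OF g d0]]
  have "Phi t \<sigma>"
    unfolding Phi_def using full_imp_tv[OF full_kernel[OF t e0]] by (auto simp: \<sigma>_def)
  then have s: "Phi t (lvec [0, 0, 0, 0, 0, 1, 1, 1, 1, 1, 1, 1])" by (simp add: \<sigma>_def)
  have H: "H t = carrier ?G"
    by (rule H_eq_SL, rule Phi_unit_vec)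
      (rule Phi_b3[OF t Phi_delta[OF Phi_m0[OF s] Phi_n0[OF s]] Phi_k0[OF s]])
  interpret G: group ?G by (rule group_SL)
  have ord: "G.ord A = q" if "A \<in> carrier ?G" "A \<noteq> \<one>\<^bsub>?G\<^esub>" "A [^]\<^bsub>?G\<^esub> q = \<one>\<^bsub>?G\<^esub>" "prime q"
    for A and q :: nat
  proof -
    have "G.ord A dvd q" using that G.pow_eq_id by simp
    moreover have "G.ord A \<noteq> 1" using that G.ord_eq_1 by simp
    ultimately show ?thesis using \<open>prime q\<close> by (auto simp: prime_nat_iff)
  qed
  \<comment> \<open>In characteristic 2 the signs disappear, so the test vector must be truly moved:
    the basis vector of index 3 goes to index 9 under \<open>X t\<close> and to index 7 under
    \<open>Y\<close>.\<close>
  have "X t \<noteq> 1\<^sub>m 12"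
  proof
    assume "X t = 1\<^sub>m 12"
    then show False
      using X_mult[of t 0 0 0 1 0 0 0 0 0 0 0 0] by simp
  qed
  moreover have "X t [^]\<^bsub>?G\<^esub> (2::nat) = \<one>\<^bsub>?G\<^esub>"
    using X_Y_in_SL(1)[of t] X_mult_X[of t] by (simp add: numeral_2_eq_2 SL_def left_mult_one_mat[OF X_carrier])
  ultimately have "G.ord (X t) = 2"
    using ord[of "X t" 2] X_Y_in_SL(1)[of t] by (simp add: SL_def)
  moreover have "G.ord Y = 3"
  proof -
    have "(Y :: 'a mat) \<noteq> 1\<^sub>m 12"
    proof
      assume *: "(Y :: 'a mat) = 1\<^sub>m 12"
      show False
        using Y_mult[of "0 :: 'a" 0 0 1 0 0 0 0 0 0 0 0] unfolding * by simp
    qed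
    moreover have "(Y :: 'a mat) [^]\<^bsub>?G\<^esub> (3::nat) = \<one>\<^bsub>?G\<^esub>"
      using X_Y_in_SL(2) Y_mult_Y_mult_Y by (simp add: numeral_3_eq_3 SL_def left_mult_one_mat[OF Y_carrier])
    ultimately show ?thesis
      using ord[of Y 3] X_Y_in_SL(2) by (simp add: SL_def)
  qed
  ultimately show ?thesis
    unfolding two_three_generated_def
    using group_SL X_Y_in_SL H by (auto simp: H_def)
qed

end
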